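(* Let $N$ be a prime number and $\delta,\alpha\in(0,1]$ real numbers with $32\delta^2\le\alpha\le\delta/4$. Suppose there is a positive integer $k$ with $2\le k\le\frac12\log(1/\delta)$ and $$2k\max\Big\{\log\Big(\frac{2^6\delta k}{\alpha^2}\Big),\ \log\Big(\frac{2^6\delta^2}{\alpha^3}\Big)\Big\}\le\log N. \qquad ( * )$$ Then there exists a set $A\subseteq\mathbb{Z}_N$ such that $\delta N\le|A|\le3\delta N$, $|\mathcal{R}_\alpha(A)|\ge\frac{\delta}{64\alpha^2}$, and for every integer $k$ with $2\le k\le\frac12\log(1/\delta)$ satisfying $( * )$ we have $T_k(\mathcal{R}_\alpha(A))\le\frac{2^{14k}\delta}{\alpha^{2k}}$.
   Context: $\mathbb{Z}_N=\mathbb{Z}/N\mathbb{Z}$; $\log$ is the logarithm to base $2$. For $f:\mathbb{Z}_N\to\mathbb{C}$, $\widehat f(r)=\sum_n f(n)e^{2\pi i nr/N}$; $A(x)$ is the indicator of $A$, and $\mathcal{R}_\alpha(A)=\{r\in\mathbb{Z}_N:|\widehat A(r)|\ge\alpha N\}$. For $B\subseteq\mathbb{Z}_N$ and a positive integer $k$, $T_k(B)=|\{(r_1,\dots,r_k,r_1',\dots,r_k')\in B^{2k}: r_1+\dots+r_k=r_1'+\dots+r_k'\}|$. *)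

theory Defs
  imports "HOL-Analysis.Analysis" "HOL-Library.FuncSet"
begin

text \<open>Z_N is modelled by the residues {0..<N} (natural numbers), addition mod N.\<close>

definition fourier :: "nat \<Rightarrow> (nat \<Rightarrow> complex) \<Rightarrow> nat \<Rightarrow> complex" where
  "fourier N f r = (\<Sum>n<N. f n * exp (2 * pi * \<i> * of_nat n * of_nat r / of_nat N))"

definition indicator_fn :: "nat set \<Rightarrow> nat \<Rightarrow> complex" where
  "indicator_fn A x = (if x \<in> A then 1 else 0)"

definition large_spectrum :: "nat \<Rightarrow> real \<Rightarrow> nat set \<Rightarrow> nat set" where
  "large_spectrum N \<alpha> A = {r \<in> {..<N}. cmod (fourier N (indicator_fn A) r) \<ge> \<alpha> * real N}"

definition T_energy :: "nat \<Rightarrow> nat \<Rightarrow> nat set \<Rightarrow> nat" where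
  "T_energy N k B = card {(x, y). x \<in> {..<k} \<rightarrow>\<^sub>E B \<and> y \<in> {..<k} \<rightarrow>\<^sub>E B \<and>
      (\<Sum>i<k. x i) mod N = (\<Sum>i<k. y i) mod N}"

definition cond_k :: "nat \<Rightarrow> real \<Rightarrow> real \<Rightarrow> nat \<Rightarrow> bool" where
  "cond_k N \<delta> \<alpha> k \<longleftrightarrow> 2 \<le> k \<and> real k \<le> 1/2 * log 2 (1/\<delta>) \<and>
     2 * real k * max (log 2 (2^6 * \<delta> * real k / \<alpha>^2)) (log 2 (2^6 * \<delta>^2 / \<alpha>^3)) \<le> log 2 (real N)"

end

theory Submission
  imports Defs "HOL-Number_Theory.Cong"
begin

text \<open>
  Take \<open>L \<approx> \<delta>/\<alpha>\<close> random multipliers \<open>q\<^sub>0, \<dots>, q\<^sub>L\<^sub>-\<^sub>1\<close> modulo \<open>N\<close>, and let \<open>A\<close> be the union of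
  the dilates \<open>A\<^sub>j = {x. q\<^sub>j x mod N < h}\<close> of an interval of length \<open>h \<approx> 3\<alpha>N\<close>. On average the
  pairwise overlaps have total size about \<open>9\<delta>\<^sup>2N \<le> 9\<alpha>N/32\<close>, so the Fourier transform of \<open>A\<close> is, up to an
  error below \<open>\<alpha>N\<close>, the sum of those of the \<open>A\<^sub>j\<close>. At \<open>r = m q\<^sub>j\<close> the transform of \<open>A\<^sub>j\<close> is that of
  the interval at \<open>m\<close>, which is at least \<open>h/2\<close> for \<open>6mh \<le> N\<close> and at most \<open>N/\<bar>m\<bar>\<close> for \<open>0 < \<bar>m\<bar> \<le> N/2\<close>.
  Since \<open>N\<close> is large, the multipliers can also be chosen such that no \<open>r \<noteq> 0\<close> is a small multiple of
  two of them; hence the large spectrum contains the \<open>m q\<^sub>j\<close> with \<open>1 \<le> m \<le> 1/(18\<alpha>)\<close> and is contained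
  in \<open>{m q\<^sub>j. \<bar>m\<bar> \<le> 2/\<alpha>}\<close>.

  The energy hypothesis on \<open>N\<close> further allows the multipliers to satisfy no nontrivial relation with
  coefficients coming from \<open>2k\<close> spectral elements. A solution counted by \<open>T\<^sub>k\<close> then has zero
  coefficient sum over each multiplier separately. If \<open>s\<close> multipliers occur this leaves at most
  \<open>(\<delta>/\<alpha>)\<^sup>s s\<^sup>2\<^sup>k (5/\<alpha>)\<^sup>2\<^sup>k\<^sup>-\<^sup>s\<close> solutions, and \<open>\<delta> \<le> 2\<^sup>-\<^sup>2\<^sup>k\<close> absorbs the factor \<open>s\<^sup>2\<^sup>k\<close>.
\<close>

section \<open>Exponential sums over dilated intervals\<close>

lemma sin_ge_over_pi:
  assumes "0 \<le> x" "x \<le> pi / 2"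
  shows "x / pi \<le> sin x"
proof (cases "x \<le> pi / 6")
  case False
  have "sin (pi / 6) \<le> sin x"
    using False assms by (intro sin_monotone_2pi_le) auto
  moreover have "x / pi \<le> 1 / 2"
    using assms by (simp add: field_simps)
  ultimately show ?thesis
    unfolding sin_30 by linarith
next
  case True
  show ?thesis
  proof (cases "x = 0")
    case False
    then have "0 < x" using assms by simp
    then obtain z where z: "0 < z" "z < x" "sin x - sin 0 = (x - 0) * cos z"
      using MVT2[of 0 x sin cos] by (auto intro: DERIV_sin)
    have "cos (pi / 3) \<le> cos z"
      using z True pi_gt_zero by (intro cos_monotone_0_pi_le) auto
    then have "x * (1 / 2) \<le> x * cos z"
      using \<open>0 < x\<close> by (intro mult_left_mono) (auto simp: cos_60)
    moreover have "x / pi \<le> x * (1 / 2)"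
      using \<open>0 < x\<close> pi_ge_two by (simp add: field_simps)
    moreover have "sin x = x * cos z"
      using z by simp
    ultimately show ?thesis
      by linarith
  qed simp
qed

lemma cis_cong_mod:
  assumes "[a = b] (mod int N)" "N > 0"
  shows "cis (2 * pi * of_int a / real N) = cis (2 * pi * of_int b / real N)"
proof -
  obtain k where "a = b + int N * k"
    using assms(1) by (metis cong_iff_lin cong_sym)
  then have "2 * pi * of_int a / real N = 2 * pi * of_int b / real N + 2 * pi * of_int k"
    using \<open>N > 0\<close> by (simp add: field_simps)
  moreover have "cis (2 * pi * of_int k) = 1"
    by (rule cis_multiple_2pi) simp
  ultimately show ?thesis
    by (metis cis_mult mult.right_neutral)
qed

definition interval_sum :: "nat \<Rightarrow> nat \<Rightarrow> int \<Rightarrow> complex" where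
  "interval_sum N h m = (\<Sum>y<h. cis (2 * pi * of_int (m * int y) / real N))"

lemma norm_interval_sum_le:
  assumes "m \<noteq> 0" "2 * \<bar>m\<bar> \<le> int N"
  shows "norm (interval_sum N h m) \<le> real N / of_int \<bar>m\<bar>"
proof -
  define t where "t = 2 * pi * of_int m / real N"
  have N: "real N > 0" using assms by simp
  have abs: "\<bar>t / 2\<bar> = pi * of_int \<bar>m\<bar> / real N"
    by (simp add: t_def abs_mult)
  have "2 * of_int \<bar>m\<bar> \<le> real N"
    using assms(2) by linarith
  then have "\<bar>t / 2\<bar> \<le> pi / 2"
    unfolding abs using N by (simp add: field_simps)
  then have "\<bar>t / 2\<bar> / pi \<le> sin \<bar>t / 2\<bar>"
    by (intro sin_ge_over_pi) auto
  also have "sin \<bar>t / 2\<bar> \<le> \<bar>sin (t / 2)\<bar>"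
    by (simp add: abs_if)
  finally have sin_ge: "of_int \<bar>m\<bar> / real N \<le> \<bar>sin (t / 2)\<bar>"
    unfolding abs by simp
  have pos: "0 < of_int \<bar>m\<bar> / real N"
    using N assms by simp
  have dist: "norm (cis t - 1) = 2 * \<bar>sin (t / 2)\<bar>"
    using dist_exp_i_1[of t] by (simp add: cis_conv_exp)
  then have ne: "cis t \<noteq> 1"
    using sin_ge pos by auto
  have "interval_sum N h m = (\<Sum>y<h. cis t ^ y)"
    unfolding interval_sum_def t_def
    by (intro sum.cong refl) (simp only: Complex.DeMoivre, simp add: ac_simps)
  also have "\<dots> = (cis t ^ h - 1) / (cis t - 1)"
    by (rule geometric_sum[OF ne])
  finally have "norm (interval_sum N h m) = norm (cis t ^ h - 1) / (2 * \<bar>sin (t / 2)\<bar>)"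
    by (simp add: norm_divide dist)
  also have "\<dots> \<le> 2 / (2 * (of_int \<bar>m\<bar> / real N))"
  proof (rule frac_le)
    show "norm (cis t ^ h - 1) \<le> 2"
      using norm_triangle_ineq4[of "cis t ^ h" 1] by (simp add: norm_power)
  qed (use sin_ge pos in auto)
  finally show ?thesis by simp
qed

lemma norm_interval_sum_ge:
  assumes "m \<ge> 0" "6 * m * int h \<le> int N"
  shows "real h / 2 \<le> norm (interval_sum N h m)"
proof -
  have "real h / 2 = (\<Sum>y<h. 1 / 2)" by simp
  also have "\<dots> \<le> (\<Sum>y<h. cos (2 * pi * of_int (m * int y) / real N))"
  proof (rule sum_mono)
    fix y assume y: "y \<in> {..<h}"
    have "6 * m * int y \<le> 6 * m * int h"
      using y assms by (intro mult_left_mono) auto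
    with assms have "6 * m * int y \<le> int N" by linarith
    then have le: "6 * (of_int m * real y) \<le> real N"
      by (metis (no_types, lifting) mult.assoc of_int_le_iff of_int_mult of_int_numeral of_int_of_nat_eq)
    have "2 * pi * of_int (m * int y) / real N \<le> pi / 3"
    proof (cases "N = 0")
      case False
      have "pi * (6 * (of_int m * real y)) \<le> pi * real N"
        using le by (intro mult_left_mono) auto
      then show ?thesis using False by (simp add: field_simps)
    qed simp
    moreover have "0 \<le> 2 * pi * of_int (m * int y) / real N"
      using assms by simp
    ultimately have "cos (pi / 3) \<le> cos (2 * pi * of_int (m * int y) / real N)"
      using pi_gt_zero by (intro cos_monotone_0_pi_le) auto
    then show "1 / 2 \<le> cos (2 * pi * of_int (m * int y) / real N)"
      by (simp add: cos_60)
  qed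
  also have "\<dots> = Re (interval_sum N h m)"
    by (simp add: interval_sum_def)
  also have "\<dots> \<le> norm (interval_sum N h m)"
    by (rule complex_Re_le_cmod)
  finally show ?thesis .
qed

definition dilate :: "nat \<Rightarrow> nat \<Rightarrow> nat \<Rightarrow> nat set" where
  "dilate N h q = {x \<in> {..<N}. q * x mod N < h}"

lemma bij_betw_mult_mod:
  fixes q N :: nat
  assumes "coprime q N"
  shows "bij_betw (\<lambda>x. q * x mod N) {..<N} {..<N}"
proof (cases "N = 0")
  case False
  have inj: "inj_on (\<lambda>x. q * x mod N) {..<N}"
  proof (rule inj_onI)
    fix x y assume xy: "x \<in> {..<N}" "y \<in> {..<N}" "q * x mod N = q * y mod N"
    then have "[x = y] (mod N)"
      using assms cong_mult_lcancel_nat unfolding cong_def by blast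
    then show "x = y" using xy by (simp add: cong_def)
  qed
  have "(\<lambda>x. q * x mod N) ` {..<N} = {..<N}"
    using False by (intro endo_inj_surj inj) auto
  with inj show ?thesis by (simp add: bij_betw_def)
qed (simp add: bij_betw_def)

lemma card_dilate:
  assumes "coprime q N" "h \<le> N"
  shows "card (dilate N h q) = h"
proof -
  have "bij_betw (\<lambda>x. q * x mod N) (dilate N h q) {..<h}"
  proof (rule bij_betw_subset[OF bij_betw_mult_mod[OF assms(1)]])
    show "(\<lambda>x. q * x mod N) ` dilate N h q = {..<h}"
    proof safe
      fix y assume "y < h"
      then have "y \<in> (\<lambda>x. q * x mod N) ` {..<N}"
        using bij_betw_mult_mod[OF assms(1)] assms(2) by (auto simp: bij_betw_def)
      with \<open>y < h\<close> show "y \<in> (\<lambda>x. q * x mod N) ` dilate N h q"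
        by (auto simp: dilate_def)
    qed (auto simp: dilate_def)
  qed (auto simp: dilate_def)
  then show ?thesis by (simp add: bij_betw_same_card)
qed

lemma fourier_dilate:
  assumes "coprime q N" "h \<le> N" "N > 0" "[int r = m * int q] (mod int N)"
  shows "fourier N (indicator_fn (dilate N h q)) r = interval_sum N h m"
proof -
  define g where "g y = (if y < h then cis (2 * pi * of_int (m * int y) / real N) else 0)" for y
  have "fourier N (indicator_fn (dilate N h q)) r = (\<Sum>x<N. g (q * x mod N))"
    unfolding fourier_def
  proof (rule sum.cong)
    fix x assume x: "x \<in> {..<N}"
    have "[int x * int r = int x * (m * int q)] (mod int N)"
      by (rule cong_mult[OF cong_refl assms(4)])
    also have "int x * (m * int q) = m * int (q * x)" by simp
    also have "[m * int (q * x) = m * int (q * x mod N)] (mod int N)"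
      by (intro cong_mult cong_refl) (simp add: cong_def zmod_int)
    finally have "cis (2 * pi * of_int (int x * int r) / real N)
        = cis (2 * pi * of_int (m * int (q * x mod N)) / real N)"
      using cis_cong_mod assms(3) by blast
    moreover have "exp (complex_of_real (2 * pi) * \<i> * of_nat x * of_nat r / of_nat N)
        = cis (2 * pi * of_int (int x * int r) / real N)"
      by (simp add: cis_conv_exp algebra_simps)
    ultimately show "indicator_fn (dilate N h q) x
        * exp (complex_of_real (2 * pi) * \<i> * of_nat x * of_nat r / of_nat N) = g (q * x mod N)"
      using x by (simp add: indicator_fn_def dilate_def g_def)
  qed simp
  also have "\<dots> = (\<Sum>y<N. g y)"
    by (rule sum.reindex_bij_betw[OF bij_betw_mult_mod[OF assms(1)]])
  also have "\<dots> = (\<Sum>y<h. g y)"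
    using assms(2) by (intro sum.mono_neutral_right) (auto simp: g_def)
  also have "\<dots> = interval_sum N h m"
    unfolding interval_sum_def by (intro sum.cong) (auto simp: g_def)
  finally show ?thesis .
qed

lemma symmetric_residue:
  fixes N q r :: nat
  assumes "coprime q N" "N > 0"
  obtains m :: int where "[int r = m * int q] (mod int N)" "2 * \<bar>m\<bar> \<le> int N"
proof -
  obtain s where "[int q * s = 1] (mod int N)"
    using assms(1) cong_solve_coprime_int[of "int q" "int N"] by auto
  then have "[int r * (int q * s) = int r * 1] (mod int N)"
    by (intro cong_mult cong_refl)
  then have c0: "[int r = (int r * s) * int q] (mod int N)"
    by (simp add: cong_sym algebra_simps)
  define u where "u = (int r * s) mod int N"
  have u: "0 \<le> u" "u < int N" using assms by (auto simp: u_def)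
  have c: "[int r = u * int q] (mod int N)"
    using c0 by (simp add: u_def cong_def mod_mult_left_eq)
  show ?thesis
  proof (cases "2 * u \<le> int N")
    case True
    then show ?thesis using that[OF c] u by simp
  next
    case False
    have "[u * int q = (u - int N) * int q] (mod int N)"
      by (intro cong_mult cong_refl) (simp add: cong_def)
    with c have "[int r = (u - int N) * int q] (mod int N)"
      by (rule cong_trans)
    then show ?thesis using that[of "u - int N"] u False by simp
  qed
qed

section \<open>Choice of the multipliers\<close>

lemma card_linear_relation_le:
  fixes c :: "nat \<Rightarrow> int"
  assumes "prime N" "l < L" "\<not> int N dvd c l"
  shows "card {q \<in> {..<L} \<rightarrow>\<^sub>E {1..<N}. [(\<Sum>l<L. c l * int (q l)) = 0] (mod int N)}
    \<le> (N - 1) ^ (L - 1)" (is "card ?S \<le> _")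
proof -
  have "card ?S \<le> card (({..<L} - {l}) \<rightarrow>\<^sub>E {1..<N})"
  proof (rule card_inj_on_le)
    show "inj_on (\<lambda>q. restrict q ({..<L} - {l})) ?S"
    proof (rule inj_onI)
      fix q q' assume q: "q \<in> ?S" and q': "q' \<in> ?S"
        and eq: "restrict q ({..<L} - {l}) = restrict q' ({..<L} - {l})"
      have off: "q i = q' i" if "i < L" "i \<noteq> l" for i
        using fun_cong[OF eq, of i] that by simp
      have split: "(\<Sum>l<L. c l * int (p l)) = c l * int (p l) + (\<Sum>i\<in>{..<L} - {l}. c i * int (p i))"
        for p using assms(2) by (subst sum.remove[of _ l]) auto
      have rest: "(\<Sum>i\<in>{..<L} - {l}. c i * int (q i)) = (\<Sum>i\<in>{..<L} - {l}. c i * int (q' i))"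
        using off by (intro sum.cong) auto
      have "[(\<Sum>l<L. c l * int (q l)) = (\<Sum>l<L. c l * int (q' l))] (mod int N)"
        using q q' by (auto intro: cong_trans cong_sym)
      then have "[c l * int (q l) = c l * int (q' l)] (mod int N)"
        unfolding split rest by (simp add: cong_add_rcancel)
      moreover have "coprime (c l) (int N)"
        using assms prime_imp_coprime[of "int N" "c l"] by (simp add: coprime_commute)
      ultimately have "[int (q l) = int (q' l)] (mod int N)"
        by (simp add: cong_mult_lcancel)
      moreover have "q l < N" "q' l < N"
        using q q' assms(2) by (auto simp: PiE_iff)
      ultimately have "q l = q' l"
        by (simp add: cong_int_iff cong_def)
      with off show "q = q'"
        using q q' by (intro PiE_ext[of q "{..<L}" "\<lambda>_. {1..<N}"]) auto
    qed
    show "(\<lambda>q. restrict q ({..<L} - {l})) ` ?S \<subseteq> ({..<L} - {l}) \<rightarrow>\<^sub>E {1..<N}"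
      by (auto simp: PiE_iff split: if_splits)
    show "finite (({..<L} - {l}) \<rightarrow>\<^sub>E {1..<N})"
      by (intro finite_PiE) auto
  qed
  also have "\<dots> = (N - 1) ^ (L - 1)"
    using assms(2) by (simp add: card_funcsetE)
  finally show ?thesis .
qed

lemma sum_card_dilate_Int_le:
  assumes "prime N" "h > 0" "h \<le> N" "i < L" "j < L" "i \<noteq> j"
  shows "(\<Sum>q \<in> {..<L} \<rightarrow>\<^sub>E {1..<N}. real (card (dilate N h (q i) \<inter> dilate N h (q j))))
    \<le> real (N - 1) ^ L * (1 + real h ^ 2 / real N)"
proof -
  let ?\<Omega> = "{..<L} \<rightarrow>\<^sub>E {1..<N}"
  have fin: "finite ?\<Omega>" by (intro finite_PiE) auto
  have N: "N \<ge> 2" using assms(1) prime_ge_2_nat by blast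
  obtain K where L: "L = Suc (Suc K)"
    using assms(4-6) by (metis Suc_lessD less_Suc0 not0_implies_Suc less_nat_zero_code)
  define E where "E x = {q \<in> ?\<Omega>. q i * x mod N < h \<and> q j * x mod N < h}" for x
  have card_E: "card (E x) = (h - 1) ^ 2 * (N - 1) ^ (L - 2)" if x: "0 < x" "x < N" for x
  proof -
    define U where "U = {t \<in> {1..<N}. t * x mod N < h}"
    have "U = dilate N h x - {0}"
      by (auto simp: U_def dilate_def mult.commute)
    moreover have "0 \<in> dilate N h x"
      using assms by (auto simp: dilate_def)
    moreover have "coprime x N"
      using x assms(1) by (metis coprime_commute nat_dvd_not_less prime_imp_coprime)
    ultimately have card_U: "card U = h - 1"
      using assms by (simp add: card_dilate)
    have "E x = (\<Pi>\<^sub>E l\<in>{..<L}. if l = i \<or> l = j then U else {1..<N})"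
    proof (intro equalityI subsetI)
      fix q assume "q \<in> E x"
      then show "q \<in> (\<Pi>\<^sub>E l\<in>{..<L}. if l = i \<or> l = j then U else {1..<N})"
        by (auto simp: E_def U_def PiE_iff)
    next
      fix q assume "q \<in> (\<Pi>\<^sub>E l\<in>{..<L}. if l = i \<or> l = j then U else {1..<N})"
      then have q: "q \<in> extensional {..<L}"
        and *: "q l \<in> (if l = i \<or> l = j then U else {1..<N})" if "l < L" for l
        using that by (auto simp: PiE_iff)
      have "q l \<in> {1..<N}" if "l < L" for l
        using *[OF that] by (auto simp: U_def split: if_splits)
      moreover have "q i \<in> U" "q j \<in> U"
        using *[OF assms(4)] *[OF assms(5)] by auto
      ultimately show "q \<in> E x"
        using q assms(4) by (auto simp: E_def U_def PiE_iff)
    qed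
    then have "card (E x) = (\<Prod>l<L. if l = i \<or> l = j then h - 1 else N - 1)"
      by (simp add: card_PiE card_U if_distrib cong: if_cong)
    also have "\<dots> = (h - 1) ^ card ({..<L} \<inter> {l. l = i \<or> l = j})
        * (N - 1) ^ card ({..<L} \<inter> - {l. l = i \<or> l = j})"
      by (simp add: prod.If_cases)
    also have "{..<L} \<inter> {l. l = i \<or> l = j} = {i, j}"
      using assms by auto
    also have "{..<L} \<inter> - {l. l = i \<or> l = j} = {..<L} - {i, j}"
      by auto
    finally show ?thesis
      using assms by (simp add: card_Diff_subset numeral_2_eq_2)
  qed
  have "(\<Sum>q\<in>?\<Omega>. real (card (dilate N h (q i) \<inter> dilate N h (q j))))
      = (\<Sum>q\<in>?\<Omega>. \<Sum>x<N. if q \<in> E x then 1 else 0)"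
  proof (rule sum.cong)
    fix q assume "q \<in> ?\<Omega>"
    then have "dilate N h (q i) \<inter> dilate N h (q j) = {x \<in> {..<N}. q \<in> E x}"
      by (auto simp: dilate_def E_def)
    then show "real (card (dilate N h (q i) \<inter> dilate N h (q j))) = (\<Sum>x<N. if q \<in> E x then 1 else 0)"
      by (simp add: sum.If_cases Int_def)
  qed simp
  also have "\<dots> = (\<Sum>x<N. \<Sum>q\<in>?\<Omega>. if q \<in> E x then 1 else 0)"
    by (rule sum.swap)
  also have "\<dots> = (\<Sum>x<N. real (card (E x)))"
    using fin by (intro sum.cong refl) (simp add: sum.If_cases, auto simp: E_def Int_def intro!: arg_cong[where f = card])
  also have "\<dots> = real (card (E 0)) + (\<Sum>x\<in>{..<N} - {0}. real (card (E x)))"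
    using N by (subst sum.remove[of _ 0]) auto
  also have "(\<Sum>x\<in>{..<N} - {0}. real (card (E x)))
      = (\<Sum>x\<in>{..<N} - {0}. real (h - 1) ^ 2 * real (N - 1) ^ (L - 2))"
    by (intro sum.cong) (auto simp: card_E)
  also have "\<dots> = real (N - 1) * (real (h - 1) ^ 2 * real (N - 1) ^ (L - 2))"
    using N by simp
  also have "real (card (E 0)) \<le> real (N - 1) ^ L"
  proof -
    have "card (E 0) \<le> card ?\<Omega>"
      using fin by (intro card_mono) (auto simp: E_def)
    then show ?thesis by (simp add: card_funcsetE flip: of_nat_power)
  qed
  also have "real (N - 1) * (real (h - 1) ^ 2 * real (N - 1) ^ (L - 2))
      \<le> real (N - 1) ^ L * (real h ^ 2 / real N)"
  proof -
    have "real (h - 1) ^ 2 * real N \<le> real (N - 1) * real h ^ 2"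
    proof -
      have "(h - 1) ^ 2 * N \<le> (N - 1) * h ^ 2"
      proof -
        obtain a where a: "h = Suc a" using assms(2) gr0_implies_Suc by blast
        obtain b where b: "N = Suc a + b" using assms(3) a le_iff_add by blast
        show ?thesis unfolding a b by (simp add: power2_eq_square algebra_simps)
      qed
      then show ?thesis by (metis of_nat_le_iff of_nat_mult of_nat_power)
    qed
    then have "real (h - 1) ^ 2 \<le> real (N - 1) * (real h ^ 2 / real N)"
      using N by (simp add: field_simps)
    then have "real (N - 1) ^ (L - 1) * real (h - 1) ^ 2
        \<le> real (N - 1) ^ (L - 1) * (real (N - 1) * (real h ^ 2 / real N))"
      by (intro mult_left_mono) auto
    moreover have "real (N - 1) ^ L = real (N - 1) ^ (L - 1) * real (N - 1)"
      "real (N - 1) ^ (L - 1) = real (N - 1) * real (N - 1) ^ (L - 2)"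
      unfolding L by simp_all
    ultimately show ?thesis
      by (simp only: ac_simps)
  qed
  finally show ?thesis
    by (simp add: distrib_left)
qed

definition overlap :: "nat \<Rightarrow> nat \<Rightarrow> nat \<Rightarrow> (nat \<Rightarrow> nat) \<Rightarrow> nat" where
  "overlap N h L q = (\<Sum>i<L. \<Sum>j\<in>{..<L} - {i}. card (dilate N h (q i) \<inter> dilate N h (q j)))"

text \<open>A first-moment argument: the sum of overlap divided by \<open>T\<close> and the number of relations
  satisfied has mean below 1.\<close>

lemma exists_multipliers:
  fixes C :: "(nat \<Rightarrow> int) set"
  assumes "prime N" "h > 0" "h \<le> N" "L > 0" "T > 0" "finite C"
    and C: "\<And>c. c \<in> C \<Longrightarrow> \<exists>l<L. \<not> int N dvd c l"
    and small: "real L ^ 2 * (1 + real h ^ 2 / real N) / T + real (card C) / real (N - 1) < 1"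
  obtains q where "q \<in> {..<L} \<rightarrow>\<^sub>E {1..<N}" "real (overlap N h L q) \<le> T"
    "\<And>c. c \<in> C \<Longrightarrow> \<not> [(\<Sum>l<L. c l * int (q l)) = 0] (mod int N)"
proof -
  let ?\<Omega> = "{..<L} \<rightarrow>\<^sub>E {1..<N}"
  let ?rel = "\<lambda>c q. [(\<Sum>l<L. c l * int (q l)) = 0] (mod int N)"
  have fin: "finite ?\<Omega>" by (intro finite_PiE) auto
  have N: "N \<ge> 2" using assms(1) prime_ge_2_nat by blast
  define b where "b = 1 + real h ^ 2 / real N"
  have b: "b \<ge> 0" by (simp add: b_def)
  define W where "W q = real (overlap N h L q) / T + (\<Sum>c\<in>C. of_bool (?rel c q))" for q
  have "(\<Sum>q\<in>?\<Omega>. real (overlap N h L q))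
      = (\<Sum>i<L. \<Sum>j\<in>{..<L} - {i}. \<Sum>q\<in>?\<Omega>. real (card (dilate N h (q i) \<inter> dilate N h (q j))))"
    unfolding overlap_def of_nat_sum
    by (subst sum.swap, intro sum.cong refl, rule sum.swap)
  also have "\<dots> \<le> (\<Sum>i<L. \<Sum>j\<in>{..<L} - {i}. real (N - 1) ^ L * b)"
    unfolding b_def using assms by (intro sum_mono sum_card_dilate_Int_le) auto
  also have "\<dots> \<le> (\<Sum>i<L. \<Sum>j<L. real (N - 1) ^ L * b)"
    using b by (intro sum_mono sum_mono2) auto
  also have "\<dots> = real (N - 1) ^ L * (real L ^ 2 * b)"
    by (simp add: power2_eq_square)
  finally have ov: "(\<Sum>q\<in>?\<Omega>. real (overlap N h L q)) \<le> real (N - 1) ^ L * (real L ^ 2 * b)" .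
  have "(\<Sum>q\<in>?\<Omega>. \<Sum>c\<in>C. of_bool (?rel c q)) = (\<Sum>c\<in>C. \<Sum>q\<in>?\<Omega>. of_bool (?rel c q) :: real)"
    by (rule sum.swap)
  also have "\<dots> = (\<Sum>c\<in>C. real (card {q \<in> ?\<Omega>. ?rel c q}))"
    using fin by (intro sum.cong refl) (simp add: of_bool_def sum.If_cases Int_def)
  also have "\<dots> \<le> (\<Sum>c\<in>C. real ((N - 1) ^ (L - 1)))"
    using C card_linear_relation_le[OF assms(1)] by (intro sum_mono) (meson of_nat_le_iff)
  also have "\<dots> = real (N - 1) ^ L * (real (card C) / real (N - 1))"
    using N assms(4) by (cases L) simp_all
  finally have rel: "(\<Sum>q\<in>?\<Omega>. \<Sum>c\<in>C. of_bool (?rel c q))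
      \<le> real (N - 1) ^ L * (real (card C) / real (N - 1))" .
  have "(\<Sum>q\<in>?\<Omega>. W q) = (\<Sum>q\<in>?\<Omega>. real (overlap N h L q)) / T
      + (\<Sum>q\<in>?\<Omega>. \<Sum>c\<in>C. of_bool (?rel c q))"
    by (simp add: W_def sum.distrib sum_divide_distrib)
  also have "\<dots> \<le> real (N - 1) ^ L * (real L ^ 2 * b) / T
      + real (N - 1) ^ L * (real (card C) / real (N - 1))"
    using ov rel assms(5) by (intro add_mono divide_right_mono) auto
  also have "\<dots> = real (N - 1) ^ L * (real L ^ 2 * b / T + real (card C) / real (N - 1))"
    by (simp add: algebra_simps)
  also have "\<dots> < real (N - 1) ^ L * 1"
    using small N unfolding b_def by (intro mult_strict_left_mono) auto
  also have "\<dots> = (\<Sum>q\<in>?\<Omega>. 1)"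
    by (simp add: card_funcsetE)
  finally obtain q where q: "q \<in> ?\<Omega>" "W q < 1"
    by (meson not_le sum_mono)
  have ge: "(\<Sum>c\<in>C. of_bool (?rel c q) :: real) \<ge> 0" by (intro sum_nonneg) auto
  show thesis
  proof
    show "q \<in> ?\<Omega>" by fact
    have "real (overlap N h L q) / T < 1" using q(2) ge by (simp add: W_def)
    then show "real (overlap N h L q) \<le> T" using assms(5) by (simp add: field_simps)
    fix c assume c: "c \<in> C"
    have "of_bool (?rel c q) \<le> (\<Sum>c\<in>C. of_bool (?rel c q) :: real)"
      using c assms(6) by (intro member_le_sum) auto
    also have "\<dots> < 1" using q(2) assms(5) ge unfolding W_def
      by (smt (verit) divide_nonneg_pos of_nat_0_le_iff)
    finally show "\<not> ?rel c q" by auto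
  qed
qed

section \<open>Counting balanced tuples\<close>

text \<open>In each fibre of \<open>j\<close> the weight of one representative is determined by the others.\<close>

lemma card_balanced_weights_le:
  fixes j :: "nat \<Rightarrow> nat" and B :: "int set"
  assumes "j \<in> {..<n} \<rightarrow> {..<L}" "finite B"
  shows "card {\<mu> \<in> {..<n} \<rightarrow>\<^sub>E B. \<forall>l<L. (\<Sum>i | i < n \<and> j i = l. \<mu> i) = 0}
    \<le> card B ^ (n - card (j ` {..<n}))" (is "card ?S \<le> _")
proof -
  define rep where "rep l = (SOME i. i < n \<and> j i = l)" for l
  have rep: "rep l < n" "j (rep l) = l" if "l \<in> j ` {..<n}" for l
    using someI_ex[of "\<lambda>i. i < n \<and> j i = l"] that unfolding rep_def by blast+
  define R where "R = rep ` j ` {..<n}"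
  have R: "R \<subseteq> {..<n}" using rep by (auto simp: R_def)
  have "inj_on rep (j ` {..<n})"
    by (metis inj_onI rep(2))
  then have card_R: "card R = card (j ` {..<n})"
    unfolding R_def by (rule card_image)
  have "card ?S \<le> card (({..<n} - R) \<rightarrow>\<^sub>E B)"
  proof (rule card_inj_on_le)
    show "inj_on (\<lambda>\<mu>. restrict \<mu> ({..<n} - R)) ?S"
    proof (rule inj_onI)
      fix \<mu> \<nu> assume m: "\<mu> \<in> ?S" and n: "\<nu> \<in> ?S"
        and eq: "restrict \<mu> ({..<n} - R) = restrict \<nu> ({..<n} - R)"
      have off: "\<mu> i = \<nu> i" if "i < n" "i \<notin> R" for i
        using fun_cong[OF eq, of i] that by simp
      have "\<mu> i = \<nu> i" if i: "i < n" "i \<in> R" for i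
      proof -
        define l where "l = j i"
        have l: "l \<in> j ` {..<n}" "l < L" using i assms by (auto simp: l_def)
        have i_rep: "i = rep l" using i rep by (auto simp: R_def l_def)
        let ?F = "{i. i < n \<and> j i = l}"
        have F: "finite ?F" "i \<in> ?F" using i by (auto simp: l_def)
        have "sum \<mu> (?F - {i}) = sum \<nu> (?F - {i})"
        proof (rule sum.cong)
          fix i' assume i': "i' \<in> ?F - {i}"
          then have "i' \<notin> R" using i_rep rep unfolding R_def by auto
          with i' show "\<mu> i' = \<nu> i'" using off by auto
        qed simp
        moreover have "sum \<mu> ?F = 0" "sum \<nu> ?F = 0"
          using m n l by auto
        ultimately show ?thesis
          using F by (simp add: sum.remove)
      qed
      with off show "\<mu> = \<nu>"
        using m n by (intro PiE_ext[of \<mu> "{..<n}" "\<lambda>_. B"]) auto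
    qed
    show "(\<lambda>\<mu>. restrict \<mu> ({..<n} - R)) ` ?S \<subseteq> ({..<n} - R) \<rightarrow>\<^sub>E B"
      by (auto simp: PiE_iff split: if_splits)
    show "finite (({..<n} - R) \<rightarrow>\<^sub>E B)"
      using assms(2) by (intro finite_PiE) auto
  qed
  also have "\<dots> = card B ^ (n - card (j ` {..<n}))"
    using R by (simp add: card_funcsetE card_Diff_subset finite_subset card_R)
  finally show ?thesis .
qed

definition balanced :: "nat \<Rightarrow> nat \<Rightarrow> int set \<Rightarrow> ((nat \<Rightarrow> nat) \<times> (nat \<Rightarrow> int)) set" where
  "balanced n L B = (SIGMA j : {..<n} \<rightarrow>\<^sub>E {..<L}.
     {\<mu> \<in> {..<n} \<rightarrow>\<^sub>E B. \<forall>l<L. (\<Sum>i | i < n \<and> j i = l. \<mu> i) = 0})"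

lemma card_balanced_le:
  assumes "finite B" "n > 0"
  shows "card (balanced n L B) \<le> (\<Sum>s = 1..n. (L choose s) * s ^ n * card B ^ (n - s))"
proof -
  let ?J = "{..<n} \<rightarrow>\<^sub>E {..<L}"
  let ?\<S> = "{S. S \<subseteq> {..<L} \<and> S \<noteq> {} \<and> card S \<le> n}"
  have finJ: "finite ?J" by (intro finite_PiE) auto
  have finB: "finite ({..<n} \<rightarrow>\<^sub>E B)" using assms by (intro finite_PiE) auto
  have "card (balanced n L B)
      = (\<Sum>j\<in>?J. card {\<mu> \<in> {..<n} \<rightarrow>\<^sub>E B. \<forall>l<L. (\<Sum>i | i < n \<and> j i = l. \<mu> i) = 0})"
    unfolding balanced_def using finJ finB by (intro card_SigmaI) auto
  also have "\<dots> \<le> (\<Sum>j\<in>?J. card B ^ (n - card (j ` {..<n})))"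
    using assms by (intro sum_mono card_balanced_weights_le) auto
  also have "\<dots> = (\<Sum>S\<in>?\<S>. \<Sum>j\<in>{j \<in> ?J. j ` {..<n} = S}. card B ^ (n - card (j ` {..<n})))"
  proof (rule sum.group[symmetric])
    show "(\<lambda>j. j ` {..<n}) ` ?J \<subseteq> ?\<S>"
      using assms card_image_le[of "{..<n}"] by (auto simp: PiE_iff)
  qed (use finJ in auto)
  also have "\<dots> \<le> (\<Sum>S\<in>?\<S>. card S ^ n * card B ^ (n - card S))"
  proof (rule sum_mono)
    fix S assume S: "S \<in> ?\<S>"
    then have fS: "finite S" using finite_subset by blast
    have "card {j \<in> ?J. j ` {..<n} = S} \<le> card ({..<n} \<rightarrow>\<^sub>E S)"
      using fS by (intro card_mono finite_PiE) (auto simp: PiE_iff extensional_def)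
    also have "\<dots> = card S ^ n" by (simp add: card_funcsetE)
    finally show "(\<Sum>j\<in>{j \<in> ?J. j ` {..<n} = S}. card B ^ (n - card (j ` {..<n})))
        \<le> card S ^ n * card B ^ (n - card S)" by simp
  qed
  also have "\<dots> = (\<Sum>s\<in>{1..n}. \<Sum>S\<in>{S \<in> ?\<S>. card S = s}. card S ^ n * card B ^ (n - card S))"
  proof (rule sum.group[symmetric])
    show "card ` ?\<S> \<subseteq> {1..n}"
    proof (intro image_subsetI)
      fix S assume S: "S \<in> ?\<S>"
      then have "finite S" using finite_subset by blast
      with S show "card S \<in> {1..n}" by (simp add: Suc_le_eq card_gt_0_iff)
    qed
  qed simp_all
  also have "\<dots> = (\<Sum>s = 1..n. (L choose s) * s ^ n * card B ^ (n - s))"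
  proof (rule sum.cong)
    fix s assume s: "s \<in> {1..n}"
    then have "{S \<in> ?\<S>. card S = s} = {S. S \<subseteq> {..<L} \<and> card S = s}"
      by auto
    then have "card {S \<in> ?\<S>. card S = s} = L choose s"
      using n_subsets[of "{..<L}" s] by simp
    then show "(\<Sum>S\<in>{S \<in> ?\<S>. card S = s}. card S ^ n * card B ^ (n - card S))
        = (L choose s) * s ^ n * card B ^ (n - s)" by simp
  qed simp
  finally show ?thesis .
qed

section \<open>The spectrum of a union of separated dilates\<close>

locale separated_dilates =
  fixes N L h :: nat and H :: int and T :: real and q :: "nat \<Rightarrow> nat"
  assumes prime_N: "prime N" and h_le: "h \<le> N" and L_pos: "L > 0" and H_pos: "H > 0"
    and q_range: "\<And>l. l < L \<Longrightarrow> 0 < q l \<and> q l < N"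
    and separated: "\<And>i j m m'. \<lbrakk>i < L; j < L; i \<noteq> j; m \<noteq> 0; \<bar>m\<bar> \<le> H; m' \<noteq> 0; \<bar>m'\<bar> \<le> H\<rbrakk>
      \<Longrightarrow> \<not> [m * int (q i) = m' * int (q j)] (mod int N)"
    and overlap_le: "real (overlap N h L q) \<le> T"
begin

definition A :: "nat set" where
  "A = (\<Union>l<L. dilate N h (q l))"

definition err :: real where
  "err = T + real L * (real N / of_int H)"

lemma N_pos: "N > 0"
  using prime_N by (simp add: prime_gt_0_nat)

lemma coprime_q: "l < L \<Longrightarrow> coprime (q l) N"
  using q_range[of l] prime_N by (metis coprime_commute nat_dvd_not_less prime_imp_coprime)

lemma A_subset: "A \<subseteq> {..<N}"
  by (auto simp: A_def dilate_def)

lemma norm_fourier_A_diff_le: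
  "norm (fourier N (indicator_fn A) r - (\<Sum>l<L. fourier N (indicator_fn (dilate N h (q l))) r)) \<le> T"
proof -
  let ?D = "\<lambda>l. dilate N h (q l)"
  let ?e = "\<lambda>x. exp (complex_of_real (2 * pi) * \<i> * of_nat x * of_nat r / of_nat N)"
  have norm_e: "norm (?e x) = 1" for x
    by (simp add: norm_exp_eq_Re)
  have pointwise: "norm (indicator_fn A x - (\<Sum>l<L. indicator_fn (?D l) x))
      \<le> (\<Sum>i<L. \<Sum>j\<in>{..<L} - {i}. of_bool (x \<in> ?D i \<inter> ?D j))" for x
  proof -
    define S where "S = {l \<in> {..<L}. x \<in> ?D l}"
    have fin: "finite S" by (simp add: S_def)
    have sum_ind: "(\<Sum>l<L. indicator_fn (?D l) x) = of_nat (card S)"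
      by (simp add: indicator_fn_def sum.If_cases S_def Int_def)
    have "(\<Sum>i<L. \<Sum>j\<in>{..<L} - {i}. of_bool (x \<in> ?D i \<inter> ?D j))
        = (\<Sum>i<L. if i \<in> S then real (card (S - {i})) else 0)"
    proof (rule sum.cong)
      fix i assume i: "i \<in> {..<L}"
      have "({..<L} - {i}) \<inter> {j. x \<in> ?D j} = S - {i}" by (auto simp: S_def)
      then show "(\<Sum>j\<in>{..<L} - {i}. of_bool (x \<in> ?D i \<inter> ?D j))
          = (if i \<in> S then real (card (S - {i})) else 0)"
        using i by (auto simp: S_def of_bool_def sum.If_cases)
    qed simp
    also have "\<dots> = (\<Sum>i\<in>S. real (card (S - {i})))"
      by (subst sum.inter_filter[symmetric]) (auto simp: S_def intro: sum.cong)
    also have "\<dots> = real (card S) * real (card S - 1)"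
      using fin by simp
    finally have rhs: "(\<Sum>i<L. \<Sum>j\<in>{..<L} - {i}. of_bool (x \<in> ?D i \<inter> ?D j))
      = real (card S) * real (card S - 1)" .
    show ?thesis
    proof (cases "S = {}")
      case True
      then have "x \<notin> A" by (auto simp: A_def S_def)
      with True show ?thesis unfolding rhs sum_ind by (simp add: indicator_fn_def)
    next
      case False
      then have "x \<in> A" by (auto simp: A_def S_def)
      obtain n where n: "card S = Suc n"
        using False fin by (metis card_0_eq not0_implies_Suc)
      have "norm (indicator_fn A x - (\<Sum>l<L. indicator_fn (?D l) x)) = real n"
        using \<open>x \<in> A\<close> unfolding sum_ind by (simp add: n indicator_fn_def)
      also have "\<dots> \<le> real (Suc n) * real n"
        by (simp add: algebra_simps)
      finally show ?thesis unfolding rhs by (simp add: n)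
    qed
  qed
  have "(\<Sum>l<L. fourier N (indicator_fn (?D l)) r) = (\<Sum>x<N. \<Sum>l<L. indicator_fn (?D l) x * ?e x)"
    unfolding fourier_def by (rule sum.swap)
  then have diff: "fourier N (indicator_fn A) r - (\<Sum>l<L. fourier N (indicator_fn (?D l)) r)
      = (\<Sum>x<N. (indicator_fn A x - (\<Sum>l<L. indicator_fn (?D l) x)) * ?e x)"
    by (simp only: fourier_def[of N "indicator_fn A"] sum_subtractf left_diff_distrib sum_distrib_right)
  have "norm (fourier N (indicator_fn A) r - (\<Sum>l<L. fourier N (indicator_fn (?D l)) r))
      \<le> (\<Sum>x<N. norm (indicator_fn A x - (\<Sum>l<L. indicator_fn (?D l) x)))"
    unfolding diff by (rule order.trans[OF norm_sum]) (simp only: norm_mult norm_e mult_1_right order.refl)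
  also have "\<dots> \<le> (\<Sum>x<N. \<Sum>i<L. \<Sum>j\<in>{..<L} - {i}. of_bool (x \<in> ?D i \<inter> ?D j))"
    using pointwise by (intro sum_mono)
  also have "\<dots> = (\<Sum>i<L. \<Sum>x<N. \<Sum>j\<in>{..<L} - {i}. of_bool (x \<in> ?D i \<inter> ?D j))"
    by (rule sum.swap)
  also have "\<dots> = (\<Sum>i<L. \<Sum>j\<in>{..<L} - {i}. \<Sum>x<N. of_bool (x \<in> ?D i \<inter> ?D j))"
    by (intro sum.cong refl sum.swap)
  also have "\<dots> = real (overlap N h L q)"
    unfolding overlap_def of_nat_sum
    by (intro sum.cong refl)
      (auto simp: of_bool_def sum.If_cases dilate_def intro!: arg_cong[where f = card])
  also have "\<dots> \<le> T" by (rule overlap_le)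
  finally show ?thesis .
qed

lemma card_A: "\<bar>real (card A) - real L * real h\<bar> \<le> T"
proof -
  have fourier_0: "fourier N (indicator_fn B) 0 = of_nat (card B)" if "B \<subseteq> {..<N}" for B
    using that by (simp add: fourier_def indicator_fn_def sum.If_cases Int_absorb1)
  have "(\<Sum>l<L. fourier N (indicator_fn (dilate N h (q l))) 0) = (\<Sum>l<L. of_nat h)"
  proof (rule sum.cong)
    fix l assume "l \<in> {..<L}"
    then have "card (dilate N h (q l)) = h" using card_dilate coprime_q h_le by simp
    then show "fourier N (indicator_fn (dilate N h (q l))) 0 = of_nat h"
      by (subst fourier_0) (auto simp: dilate_def)
  qed simp
  then have "norm (of_nat (card A) - of_nat (L * h) :: complex) \<le> T"
    using norm_fourier_A_diff_le[of 0] by (simp add: fourier_0[OF A_subset])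
  moreover have "of_nat (card A) - of_nat (L * h) = complex_of_real (real (card A) - real L * real h)"
    by simp
  ultimately show ?thesis
    by (metis norm_of_real real_norm_def)
qed

lemma card_A_le: "card A \<le> L * h"
proof -
  have "card A \<le> (\<Sum>l<L. card (dilate N h (q l)))"
    unfolding A_def by (rule card_UN_le) simp
  also have "\<dots> = (\<Sum>l<L. h)"
    using card_dilate coprime_q h_le by simp
  finally show ?thesis by simp
qed

lemma norm_fourier_dilate_le:
  assumes "l < L" "0 < r" "r < N"
    and far: "\<And>m. m \<noteq> 0 \<Longrightarrow> [int r = m * int (q l)] (mod int N) \<Longrightarrow> H < \<bar>m\<bar>"
  shows "norm (fourier N (indicator_fn (dilate N h (q l))) r) \<le> real N / of_int H"
proof -
  obtain m where m: "[int r = m * int (q l)] (mod int N)" "2 * \<bar>m\<bar> \<le> int N"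
    using symmetric_residue[OF coprime_q[OF assms(1)] N_pos] by blast
  have "m \<noteq> 0"
    using m(1) assms(2,3) by (auto simp: cong_def)
  with far m have H: "H < \<bar>m\<bar>" by blast
  have "norm (fourier N (indicator_fn (dilate N h (q l))) r) = norm (interval_sum N h m)"
    using fourier_dilate[OF coprime_q[OF assms(1)] h_le N_pos m(1)] by simp
  also have "\<dots> \<le> real N / of_int \<bar>m\<bar>"
    using norm_interval_sum_le \<open>m \<noteq> 0\<close> m(2) by blast
  also have "\<dots> \<le> real N / of_int H"
    using H H_pos by (intro divide_left_mono mult_pos_pos) linarith+
  finally show ?thesis .
qed

lemma fourier_far:
  assumes "0 < r" "r < N"
    and "\<And>l m. l < L \<Longrightarrow> m \<noteq> 0 \<Longrightarrow> [int r = m * int (q l)] (mod int N) \<Longrightarrow> H < \<bar>m\<bar>"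
  shows "norm (fourier N (indicator_fn A) r) \<le> err"
proof -
  let ?f = "\<lambda>l. fourier N (indicator_fn (dilate N h (q l))) r"
  have "norm (\<Sum>l<L. ?f l) \<le> (\<Sum>l<L. real N / of_int H)"
    using assms by (intro sum_norm_le norm_fourier_dilate_le) auto
  moreover have "norm (fourier N (indicator_fn A) r) \<le>
      norm (fourier N (indicator_fn A) r - (\<Sum>l<L. ?f l)) + norm (\<Sum>l<L. ?f l)"
    using norm_triangle_sub[of "fourier N (indicator_fn A) r" "\<Sum>l<L. ?f l"] by linarith
  ultimately show ?thesis
    using norm_fourier_A_diff_le[of r] by (simp add: err_def)
qed

lemma fourier_near:
  assumes "0 < r" "r < N" "j < L" "m \<noteq> 0" "\<bar>m\<bar> \<le> H"
    and m: "[int r = m * int (q j)] (mod int N)"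
  shows "norm (fourier N (indicator_fn A) r - interval_sum N h m) \<le> err"
proof -
  let ?f = "\<lambda>l. fourier N (indicator_fn (dilate N h (q l))) r"
  have "norm (\<Sum>l\<in>{..<L} - {j}. ?f l) \<le> (\<Sum>l\<in>{..<L} - {j}. real N / of_int H)"
  proof (rule sum_norm_le)
    fix l assume l: "l \<in> {..<L} - {j}"
    show "norm (?f l) \<le> real N / of_int H"
    proof (rule norm_fourier_dilate_le)
      fix m' assume m': "m' \<noteq> 0" "[int r = m' * int (q l)] (mod int N)"
      have "[m * int (q j) = m' * int (q l)] (mod int N)"
        using m m'(2) cong_trans cong_sym by blast
      then show "H < \<bar>m'\<bar>"
        using separated[of j l m m'] assms l m'(1) by force
    qed (use l assms in auto)
  qed
  also have "\<dots> \<le> (\<Sum>l<L. real N / of_int H)"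
    using H_pos by (intro sum_mono2) auto
  finally have rest: "norm (\<Sum>l\<in>{..<L} - {j}. ?f l) \<le> real L * (real N / of_int H)" by simp
  have "?f j = interval_sum N h m"
    using fourier_dilate[OF coprime_q[OF assms(3)] h_le N_pos m] .
  then have "(\<Sum>l<L. ?f l) = interval_sum N h m + (\<Sum>l\<in>{..<L} - {j}. ?f l)"
    using assms(3) by (subst sum.remove[of _ j]) auto
  then have "fourier N (indicator_fn A) r - interval_sum N h m
      = (fourier N (indicator_fn A) r - (\<Sum>l<L. ?f l)) + (\<Sum>l\<in>{..<L} - {j}. ?f l)"
    by simp
  also have "norm \<dots> \<le> T + real L * (real N / of_int H)"
    using norm_fourier_A_diff_le[of r] rest by (intro norm_triangle_mono)
  finally show ?thesis by (simp add: err_def)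
qed

lemma large_spectrum_subset:
  assumes "\<alpha> > 0" "2 * err \<le> \<alpha> * real N" and r: "r \<in> large_spectrum N \<alpha> A"
  obtains j m where "j < L" "\<bar>m\<bar> \<le> \<lfloor>2 / \<alpha>\<rfloor>" "[int r = m * int (q j)] (mod int N)"
proof (cases "r = 0")
  case True
  then show ?thesis using that[of 0 0] L_pos assms(1) by simp
next
  case False
  have r: "r < N" "\<alpha> * real N \<le> norm (fourier N (indicator_fn A) r)"
    using r by (auto simp: large_spectrum_def)
  have "\<not> norm (fourier N (indicator_fn A) r) \<le> err"
    using r assms N_pos mult_pos_pos[of \<alpha> "real N"] by linarith
  then obtain l m' where l: "l < L" "m' \<noteq> 0" "[int r = m' * int (q l)] (mod int N)" "\<not> H < \<bar>m'\<bar>"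
    using fourier_far False r(1) by blast
  obtain m where m: "[int r = m * int (q l)] (mod int N)" "2 * \<bar>m\<bar> \<le> int N"
    using symmetric_residue[OF coprime_q[OF l(1)] N_pos] by blast
  have "m \<noteq> 0"
    using m(1) False r(1) by (auto simp: cong_def)
  have same: "interval_sum N h m = interval_sum N h m'"
    using fourier_dilate[OF coprime_q[OF l(1)] h_le N_pos] m(1) l(3) by metis
  have "norm (fourier N (indicator_fn A) r) \<le> norm (interval_sum N h m) + err"
    using fourier_near[of r l m'] False r(1) l norm_triangle_sub[of "fourier N (indicator_fn A) r" "interval_sum N h m"]
    unfolding same by linarith
  also have "norm (interval_sum N h m) \<le> real N / of_int \<bar>m\<bar>"
    using norm_interval_sum_le \<open>m \<noteq> 0\<close> m(2) by blast
  finally have "\<alpha> * real N / 2 \<le> real N / of_int \<bar>m\<bar>"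
    using r(2) assms(2) by linarith
  then have "of_int \<bar>m\<bar> \<le> 2 / \<alpha>"
    using \<open>m \<noteq> 0\<close> N_pos assms(1) by (simp add: field_simps)
  then have "\<bar>m\<bar> \<le> \<lfloor>2 / \<alpha>\<rfloor>"
    by (simp add: le_floor_iff)
  with that l(1) m(1) show ?thesis by blast
qed

lemma card_large_spectrum_ge:
  assumes "int m0 \<le> H" "6 * m0 * h \<le> N" "h > 0" "m0 < N" "\<alpha> * real N + err \<le> real h / 2"
  shows "L * m0 \<le> card (large_spectrum N \<alpha> A)"
proof -
  let ?g = "\<lambda>(j, m). m * q j mod N"
  have res: "[int (m * q j mod N) = int m * int (q j)] (mod int N)" for m j
    by (simp add: cong_def zmod_int)
  have inj: "inj_on ?g ({..<L} \<times> {1..m0})"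
  proof (rule inj_onI)
    fix p p' assume p: "p \<in> {..<L} \<times> {1..m0}" "p' \<in> {..<L} \<times> {1..m0}" "?g p = ?g p'"
    obtain j m j' m' where pp: "p = (j, m)" "p' = (j', m')" by fastforce
    with p have 1: "j \<in> {..<L}" "m \<in> {1..m0}" "j' \<in> {..<L}" "m' \<in> {1..m0}"
      and eq: "m * q j mod N = m' * q j' mod N" by auto
    have c: "[int m * int (q j) = int m' * int (q j')] (mod int N)"
      using res[of m j] res[of m' j'] eq by (metis cong_sym cong_trans)
    have "j = j'"
    proof (rule ccontr)
      assume "j \<noteq> j'"
      then show False using separated[of j j' "int m" "int m'"] c 1 assms(1) by auto
    qed
    moreover have "m = m'"
    proof -
      have "[m * q j = m' * q j] (mod N)"
        using eq \<open>j = j'\<close> by (simp add: cong_def)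
      then have "[m = m'] (mod N)"
        using coprime_q[of j] 1(1) cong_mult_rcancel_nat by auto
      then show ?thesis using 1 assms(4) by (simp add: cong_def)
    qed
    ultimately show "p = p'" by (simp add: pp)
  qed
  have "?g ` ({..<L} \<times> {1..m0}) \<subseteq> large_spectrum N \<alpha> A"
  proof (rule image_subsetI)
    fix p assume "p \<in> {..<L} \<times> {1..m0}"
    then obtain j m where p: "p = (j, m)" and jm: "j \<in> {..<L}" "m \<in> {1..m0}" by blast
    let ?r = "m * q j mod N"
    have "\<not> N dvd m * q j"
    proof
      assume "N dvd m * q j"
      then have "N dvd m \<or> N dvd q j" using prime_N prime_dvd_mult_nat by blast
      then show False using jm assms(4) q_range[of j] by (auto dest: dvd_imp_le)
    qed
    then have r: "0 < ?r" "?r < N" using N_pos by (auto simp: mod_greater_zero_iff_not_dvd)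
    have "norm (fourier N (indicator_fn A) ?r - interval_sum N h (int m)) \<le> err"
      using jm assms(1) by (intro fourier_near[OF r _ _ _ res]) auto
    moreover have "real h / 2 \<le> norm (interval_sum N h (int m))"
    proof (rule norm_interval_sum_ge)
      have "6 * m * h \<le> 6 * m0 * h" using jm by simp
      then have "6 * m * h \<le> N" using assms(2) by linarith
      then show "6 * int m * int h \<le> int N"
        by (metis of_nat_le_iff of_nat_mult of_nat_numeral)
    qed simp
    moreover have "norm (interval_sum N h (int m)) \<le> norm (fourier N (indicator_fn A) ?r)
        + norm (fourier N (indicator_fn A) ?r - interval_sum N h (int m))"
      by (metis norm_minus_commute norm_triangle_sub)
    ultimately show "?g p \<in> large_spectrum N \<alpha> A"
      using assms(5) r by (simp add: p large_spectrum_def)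
  qed
  then have "card (?g ` ({..<L} \<times> {1..m0})) \<le> card (large_spectrum N \<alpha> A)"
    by (intro card_mono) (auto simp: large_spectrum_def)
  then show ?thesis
    using inj by (simp add: card_image card_cartesian_product)
qed

end

lemma sum_lessThan_add:
  fixes f :: "nat \<Rightarrow> 'a::comm_monoid_add"
  shows "(\<Sum>i<m + n. f i) = (\<Sum>i<m. f i) + (\<Sum>i<n. f (m + i))"
  by (induction n) (simp_all add: ac_simps)

text \<open>The second half of an energy tuple enters with negated weights, which turns the equation
  \<open>x\<^sub>1 + \<dots> + x\<^sub>k = y\<^sub>1 + \<dots> + y\<^sub>k\<close> into one linear relation of length \<open>k + k\<close>.\<close>

lemma T_energy_le_card_balanced:
  fixes B :: "int set"
  assumes "N > 0" "R \<subseteq> {..<N}" "finite B" and sym: "\<And>m. m \<in> B \<Longrightarrow> - m \<in> B"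
    and R: "\<And>r. r \<in> R \<Longrightarrow> \<exists>j<L. \<exists>m\<in>B. [int r = m * int (q j)] (mod int N)"
    and diss: "\<And>j \<mu>. \<lbrakk>j \<in> {..<k + k} \<rightarrow>\<^sub>E {..<L}; \<mu> \<in> {..<k + k} \<rightarrow>\<^sub>E B;
        [(\<Sum>i<k + k. \<mu> i * int (q (j i))) = 0] (mod int N)\<rbrakk>
      \<Longrightarrow> \<forall>l<L. (\<Sum>i | i < k + k \<and> j i = l. \<mu> i) = 0"
  shows "T_energy N k R \<le> card (balanced (k + k) L B)"
proof -
  obtain J W where JW: "\<And>r. r \<in> R \<Longrightarrow> J r < L \<and> W r \<in> B \<and> [int r = W r * int (q (J r))] (mod int N)"
    using R by metis
  have JL: "J r < L" and WB: "W r \<in> B" if "r \<in> R" for r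
    using JW[OF that] by auto
  define E where "E = {(x, y). x \<in> {..<k} \<rightarrow>\<^sub>E R \<and> y \<in> {..<k} \<rightarrow>\<^sub>E R \<and>
      (\<Sum>i<k. x i) mod N = (\<Sum>i<k. y i) mod N}"
  define \<phi> where "\<phi> = (\<lambda>(x :: nat \<Rightarrow> nat, y :: nat \<Rightarrow> nat).
    (\<lambda>i\<in>{..<k + k}. if i < k then J (x i) else J (y (i - k)),
     \<lambda>i\<in>{..<k + k}. if i < k then W (x i) else - W (y (i - k))))"
  have eqI: "r = r'" if "r \<in> R" "r' \<in> R" "J r = J r'" "W r = W r'" for r r'
  proof -
    have "[int r = int r'] (mod int N)"
      using JW[OF that(1)] JW[OF that(2)] that(3,4) by (metis cong_sym cong_trans)
    then have "[r = r'] (mod N)"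
      by (simp only: cong_int_iff)
    then have "r mod N = r' mod N"
      by (simp only: cong_def)
    moreover have "r < N" "r' < N"
      using that(1,2) assms(2) by auto
    ultimately show ?thesis by simp
  qed
  have inj: "inj_on \<phi> E"
  proof (rule inj_onI)
    fix p p' assume p: "p \<in> E" "p' \<in> E" "\<phi> p = \<phi> p'"
    obtain x y x' y' where pp: "p = (x, y)" "p' = (x', y')" by fastforce
    with p have e: "(x, y) \<in> E" "(x', y') \<in> E"
      and eq: "fst (\<phi> (x, y)) i = fst (\<phi> (x', y')) i" "snd (\<phi> (x, y)) i = snd (\<phi> (x', y')) i" for i
      by auto
    have mem: "x i \<in> R" "y i \<in> R" "x' i \<in> R" "y' i \<in> R" if "i < k" for i
      using e that by (auto simp: E_def PiE_iff)
    have 1: "(if i < k then J (x i) else J (y (i - k))) = (if i < k then J (x' i) else J (y' (i - k)))"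
      and 2: "(if i < k then W (x i) else - W (y (i - k))) = (if i < k then W (x' i) else - W (y' (i - k)))"
      if "i < k + k" for i
      using eq[of i] that by (simp_all add: \<phi>_def)
    have "x i = x' i" if "i < k" for i
      using 1[of i] 2[of i] that mem[OF that] by - (rule eqI, auto)
    moreover have "y i = y' i" if "i < k" for i
      using 1[of "k + i"] 2[of "k + i"] that mem[OF that] by - (rule eqI, auto)
    ultimately have "x = x'" "y = y'"
      using e unfolding E_def by (auto intro!: PiE_ext[of _ "{..<k}" "\<lambda>_. R"])
    then show "p = p'" by (simp add: pp)
  qed
  have "\<phi> ` E \<subseteq> balanced (k + k) L B"
  proof (rule image_subsetI)
    fix p assume "p \<in> E"
    then obtain x y where p: "p = (x, y)" and e: "(x, y) \<in> E" by (cases p) auto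
    have mem: "x i \<in> R" "y i \<in> R" if "i < k" for i
      using e that by (auto simp: E_def PiE_iff)
    define j where j: "j = (\<lambda>i\<in>{..<k + k}. if i < k then J (x i) else J (y (i - k)))"
    define \<mu> where \<mu>: "\<mu> = (\<lambda>i\<in>{..<k + k}. if i < k then W (x i) else - W (y (i - k)))"
    have \<phi>: "\<phi> (x, y) = (j, \<mu>)"
      by (simp only: \<phi>_def j \<mu> prod.case)
    have jE: "j \<in> {..<k + k} \<rightarrow>\<^sub>E {..<L}"
      unfolding j restrict_PiE_iff using JL mem by simp
    have \<mu>E: "\<mu> \<in> {..<k + k} \<rightarrow>\<^sub>E B"
      unfolding \<mu> restrict_PiE_iff using WB mem sym by simp
    have "(\<Sum>i<k + k. \<mu> i * int (q (j i)))
        = (\<Sum>i<k. W (x i) * int (q (J (x i)))) - (\<Sum>i<k. W (y i) * int (q (J (y i))))"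
      by (simp add: sum_lessThan_add j \<mu> sum_negf)
    also have "[\<dots> = (\<Sum>i<k. int (x i)) - (\<Sum>i<k. int (y i))] (mod int N)"
      using JW mem by (intro cong_diff cong_sum) (auto simp: cong_sym)
    also have "[(\<Sum>i<k. int (x i)) - (\<Sum>i<k. int (y i)) = 0] (mod int N)"
    proof -
      have "[(\<Sum>i<k. x i) = (\<Sum>i<k. y i)] (mod N)"
        using e by (auto simp: E_def cong_def)
      then have "[int (\<Sum>i<k. x i) = int (\<Sum>i<k. y i)] (mod int N)"
        by (simp only: cong_int_iff)
      then show ?thesis
        by (simp add: cong_diff_iff_cong_0)
    qed
    finally have "[(\<Sum>i<k + k. \<mu> i * int (q (j i))) = 0] (mod int N)" .
    from diss[OF jE \<mu>E this] show "\<phi> p \<in> balanced (k + k) L B"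
      using jE \<mu>E by (simp add: p \<phi> balanced_def)
  qed
  moreover have "finite (balanced (k + k) L B)"
  proof (rule finite_subset)
    show "balanced (k + k) L B \<subseteq> ({..<k + k} \<rightarrow>\<^sub>E {..<L}) \<times> ({..<k + k} \<rightarrow>\<^sub>E B)"
      by (auto simp: balanced_def)
    show "finite (({..<k + k} \<rightarrow>\<^sub>E {..<L}) \<times> ({..<k + k} \<rightarrow>\<^sub>E B))"
      using assms(3) by (intro finite_cartesian_product finite_PiE) auto
  qed
  ultimately have "card E \<le> card (balanced (k + k) L B)"
    using inj by (intro card_inj_on_le[of \<phi>]) auto
  then show ?thesis by (simp add: T_energy_def E_def)
qed

definition tuple_coeff :: "nat \<Rightarrow> (nat \<Rightarrow> nat) \<Rightarrow> (nat \<Rightarrow> int) \<Rightarrow> nat \<Rightarrow> int" where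
  "tuple_coeff n j \<mu> l = (\<Sum>i | i < n \<and> j i = l. \<mu> i)"

lemma sum_tuple_coeff:
  assumes "j \<in> {..<n} \<rightarrow> {..<L}"
  shows "(\<Sum>l<L. tuple_coeff n j \<mu> l * q l) = (\<Sum>i<n. \<mu> i * q (j i))"
proof -
  have "(\<Sum>i<n. \<mu> i * q (j i)) = (\<Sum>l<L. \<Sum>i\<in>{i \<in> {..<n}. j i = l}. \<mu> i * q (j i))"
    using assms by (intro sum.group[symmetric]) auto
  also have "\<dots> = (\<Sum>l<L. tuple_coeff n j \<mu> l * q l)"
    unfolding tuple_coeff_def sum_distrib_right by (intro sum.cong) auto
  finally show ?thesis by simp
qed

text \<open>Separation and independence are both the absence of relations from an explicit finite set of
  coefficient vectors; shorter relations are padded with weight 0 to length \<open>n\<close>.\<close>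

lemma exists_separated_dilates:
  fixes H M :: int
  assumes "prime N" "h > 0" "h \<le> N" "L > 0" "T > 0" "0 < H" "H < int N" "0 \<le> M" "int n * M < int N"
    and small: "real L ^ 2 * (1 + real h ^ 2 / real N) / T
      + ((real L * (2 * of_int H + 1)) ^ 2 + (real L * (2 * of_int M + 1)) ^ n) / real (N - 1) < 1"
  obtains q where "separated_dilates N L h H T q"
    "\<And>k j \<mu>. \<lbrakk>k \<le> n; j \<in> {..<k} \<rightarrow>\<^sub>E {..<L}; \<mu> \<in> {..<k} \<rightarrow>\<^sub>E {- M..M};
        [(\<Sum>i<k. \<mu> i * int (q (j i))) = 0] (mod int N)\<rbrakk>
      \<Longrightarrow> \<forall>l<L. (\<Sum>i | i < k \<and> j i = l. \<mu> i) = 0"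
proof -
  define pair where "pair = (\<lambda>(i :: nat, j :: nat, m, m') l. if l = i then m else if l = j then - m' else 0 :: int)"
  define X where "X = {..<L} \<times> {..<L} \<times> {- H..H} \<times> {- H..H}"
  define Y where "Y = ({..<n} \<rightarrow>\<^sub>E {..<L}) \<times> ({..<n} \<rightarrow>\<^sub>E {- M..M})"
  define C1 where "C1 = pair ` {(i, j, m, m') \<in> X. i \<noteq> j \<and> m \<noteq> 0}"
  define C2 where "C2 = {c \<in> (\<lambda>(j, \<mu>). tuple_coeff n j \<mu>) ` Y. \<exists>l<L. c l \<noteq> 0}"
  have finX: "finite X" and finY: "finite Y"
    unfolding X_def Y_def by (intro finite_cartesian_product finite_PiE, auto)+
  have "card C1 \<le> card X"
    unfolding C1_def using finX by (intro order.trans[OF card_image_le card_mono] finite_subset[OF _ finX]) auto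
  also have "card X = (L * nat (2 * H + 1)) ^ 2"
    by (simp add: X_def card_cartesian_product power2_eq_square)
  finally have card1: "real (card C1) \<le> (real L * (2 * of_int H + 1)) ^ 2"
    using assms(6) by (simp add: of_nat_le_iff[where 'a = real, symmetric] of_nat_nat)
  have "card C2 \<le> card ((\<lambda>(j, \<mu>). tuple_coeff n j \<mu>) ` Y)"
    unfolding C2_def using finY by (intro card_mono) auto
  also have "\<dots> \<le> card Y"
    by (rule card_image_le[OF finY])
  also have "card Y = (L * nat (2 * M + 1)) ^ n"
    by (simp add: Y_def card_cartesian_product card_funcsetE power_mult_distrib)
  finally have card2: "real (card C2) \<le> (real L * (2 * of_int M + 1)) ^ n"
    using assms(8) by (simp add: of_nat_le_iff[where 'a = real, symmetric] of_nat_nat)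
  have small': "real L ^ 2 * (1 + real h ^ 2 / real N) / T + real (card (C1 \<union> C2)) / real (N - 1) < 1"
  proof -
    have "real (card (C1 \<union> C2)) \<le> real (card C1) + real (card C2)"
      using card_Un_le[of C1 C2] by linarith
    also have "\<dots> \<le> (real L * (2 * of_int H + 1)) ^ 2 + (real L * (2 * of_int M + 1)) ^ n"
      using card1 card2 by (rule add_mono)
    finally have "real (card (C1 \<union> C2)) / real (N - 1)
        \<le> ((real L * (2 * of_int H + 1)) ^ 2 + (real L * (2 * of_int M + 1)) ^ n) / real (N - 1)"
      by (rule divide_right_mono) simp
    then show ?thesis
      by (rule le_less_trans[OF add_left_mono small])
  qed
  have not_dvd: "\<not> int N dvd x" if "x \<noteq> 0" "\<bar>x\<bar> < int N" for x
    using that dvd_imp_le_int[of x "int N"] by auto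
  have nz: "\<exists>l<L. \<not> int N dvd c l" if "c \<in> C1 \<union> C2" for c
    using that
  proof
    assume "c \<in> C1"
    then obtain i j m m' where c: "c = pair (i, j, m, m')" "i < L" "m \<in> {- H..H}" "m \<noteq> 0"
      unfolding C1_def X_def by auto
    then have "c i = m" by (simp add: pair_def)
    moreover have "\<not> int N dvd m" using c assms(7) by (intro not_dvd) auto
    ultimately show ?thesis using c(2) by blast
  next
    assume "c \<in> C2"
    then obtain j \<mu> l where c: "c = tuple_coeff n j \<mu>" "\<mu> \<in> {..<n} \<rightarrow>\<^sub>E {- M..M}" "l < L" "c l \<noteq> 0"
      unfolding C2_def Y_def by auto
    have "\<bar>c l\<bar> \<le> (\<Sum>i | i < n \<and> j i = l. \<bar>\<mu> i\<bar>)"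
      unfolding c tuple_coeff_def by (rule sum_abs)
    also have "\<dots> \<le> (\<Sum>i<n. \<bar>\<mu> i\<bar>)"
      by (intro sum_mono2) auto
    also have "\<dots> \<le> (\<Sum>i<n. M)"
    proof (rule sum_mono)
      fix i assume "i \<in> {..<n}"
      then have "\<mu> i \<in> {- M..M}" using c(2) by (rule PiE_mem[rotated])
      then show "\<bar>\<mu> i\<bar> \<le> M" by auto
    qed
    finally show ?thesis using not_dvd[OF c(4)] c(3) assms(9) by fastforce
  qed
  have "finite C1"
    unfolding C1_def by (intro finite_imageI finite_subset[OF _ finX]) auto
  moreover have "finite C2"
    unfolding C2_def by (rule finite_subset[OF _ finite_imageI[OF finY]]) blast
  ultimately have finC: "finite (C1 \<union> C2)" by (rule finite_UnI)
  obtain q where q: "q \<in> {..<L} \<rightarrow>\<^sub>E {1..<N}" "real (overlap N h L q) \<le> T"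
    and C: "\<And>c. c \<in> C1 \<union> C2 \<Longrightarrow> \<not> [(\<Sum>l<L. c l * int (q l)) = 0] (mod int N)"
    by (rule exists_multipliers[OF assms(1-5) finC nz small'], assumption, rule that, assumption+)
  show thesis
  proof (rule that)
    show "separated_dilates N L h H T q"
    proof unfold_locales
      fix l assume "l < L"
      then have "q l \<in> {1..<N}" using PiE_mem[OF q(1), of l] by simp
      then show "0 < q l \<and> q l < N" by auto
    next
      fix i j m m' assume ij: "i < L" "j < L" "i \<noteq> j" "m \<noteq> 0" "\<bar>m\<bar> \<le> H" "m' \<noteq> 0" "\<bar>m'\<bar> \<le> H"
      then have "(i, j, m, m') \<in> {(i, j, m, m') \<in> X. i \<noteq> j \<and> m \<noteq> 0}"
        by (auto simp: X_def)
      then have "pair (i, j, m, m') \<in> C1 \<union> C2"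
        unfolding C1_def by blast
      moreover have "(\<Sum>l<L. pair (i, j, m, m') l * int (q l)) = m * int (q i) - m' * int (q j)"
      proof -
        have "(\<Sum>l<L. pair (i, j, m, m') l * int (q l)) = (\<Sum>l\<in>{i, j}. pair (i, j, m, m') l * int (q l))"
          using ij by (intro sum.mono_neutral_right) (auto simp: pair_def)
        then show ?thesis using ij(3) by (simp add: pair_def)
      qed
      ultimately have "\<not> [m * int (q i) - m' * int (q j) = 0] (mod int N)"
        using C by metis
      then show "\<not> [m * int (q i) = m' * int (q j)] (mod int N)"
        by (simp add: cong_diff_iff_cong_0)
    qed (use assms q(2) in auto)
  next
    fix k j \<mu> assume k: "k \<le> n" "j \<in> {..<k} \<rightarrow>\<^sub>E {..<L}" "\<mu> \<in> {..<k} \<rightarrow>\<^sub>E {- M..M}"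
      and rel: "[(\<Sum>i<k. \<mu> i * int (q (j i))) = 0] (mod int N)"
    define j' where "j' = (\<lambda>i\<in>{..<n}. if i < k then j i else 0)"
    define \<mu>' where "\<mu>' = (\<lambda>i\<in>{..<n}. if i < k then \<mu> i else 0)"
    have j': "j' \<in> {..<n} \<rightarrow>\<^sub>E {..<L}"
      unfolding j'_def restrict_PiE_iff using k(2) assms(4) by auto
    have \<mu>': "\<mu>' \<in> {..<n} \<rightarrow>\<^sub>E {- M..M}"
      unfolding \<mu>'_def restrict_PiE_iff
    proof
      fix i
      show "(if i < k then \<mu> i else 0) \<in> {- M..M}"
        using PiE_mem[OF k(3), of i] assms(8) by auto
    qed
    have coeff: "tuple_coeff n j' \<mu>' l = (\<Sum>i | i < k \<and> j i = l. \<mu> i)" for l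
    proof -
      have "tuple_coeff n j' \<mu>' l = (\<Sum>i | i < k \<and> j i = l. \<mu>' i)"
        unfolding tuple_coeff_def using k(1)
        by (intro sum.mono_neutral_right) (auto simp: j'_def \<mu>'_def)
      also have "\<dots> = (\<Sum>i | i < k \<and> j i = l. \<mu> i)"
        using k(1) by (intro sum.cong) (auto simp: \<mu>'_def)
      finally show ?thesis .
    qed
    have "(\<Sum>l<L. tuple_coeff n j' \<mu>' l * int (q l)) = (\<Sum>i<n. \<mu>' i * int (q (j' i)))"
      using j' by (intro sum_tuple_coeff[of j' n L \<mu>' "\<lambda>l. int (q l)"]) (auto simp: PiE_iff)
    also have "\<dots> = (\<Sum>i<k. \<mu>' i * int (q (j' i)))"
      using k(1) by (intro sum.mono_neutral_right) (auto simp: \<mu>'_def)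
    also have "\<dots> = (\<Sum>i<k. \<mu> i * int (q (j i)))"
      using k(1) by (intro sum.cong) (auto simp: \<mu>'_def j'_def)
    finally have "tuple_coeff n j' \<mu>' \<notin> C2"
      using rel C by fastforce
    moreover have "tuple_coeff n j' \<mu>' \<in> (\<lambda>(j, \<mu>). tuple_coeff n j \<mu>) ` Y"
      using j' \<mu>' unfolding Y_def by force
    ultimately show "\<forall>l<L. (\<Sum>i | i < k \<and> j i = l. \<mu> i) = 0"
      unfolding C2_def using coeff by auto
  qed
qed

lemma sum_choose_power_le:
  fixes d P :: real
  assumes "0 < d" "d * 2 ^ n \<le> 1" "real L \<le> d * P" "0 < P"
  shows "(\<Sum>s = 1..n. real (L choose s) * real s ^ n * P ^ (n - s)) \<le> real n * (d * P ^ n)"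
proof -
  have "(\<Sum>s = 1..n. real (L choose s) * real s ^ n * P ^ (n - s)) \<le> (\<Sum>s = 1..n. d * P ^ n)"
  proof (rule sum_mono)
    fix s assume s: "s \<in> {1..n}"
    then obtain t where t: "s = Suc t" by (cases s) auto
    have "L choose s \<le> L ^ s"
      by (cases "s \<le> L") (auto simp: binomial_le_pow binomial_eq_0)
    then have "real (L choose s) \<le> real L ^ s"
      by (metis of_nat_le_iff of_nat_power)
    also have "\<dots> \<le> (d * P) ^ s"
      using assms by (intro power_mono) auto
    finally have "real (L choose s) * real s ^ n * P ^ (n - s) \<le> (d * P) ^ s * real s ^ n * P ^ (n - s)"
      using assms by (intro mult_right_mono) auto
    also have "\<dots> = (d ^ s * real s ^ n) * (P ^ s * P ^ (n - s))"
      by (simp add: power_mult_distrib)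
    also have "P ^ s * P ^ (n - s) = P ^ n"
      using s by (simp flip: power_add)
    also have "d ^ s * real s ^ n \<le> d"
    proof -
      have "s \<le> 2 ^ t"
        unfolding t using less_exp[of t] by (simp add: Suc_le_eq)
      then have "real s \<le> 2 ^ t"
        by (metis of_nat_le_iff of_nat_numeral of_nat_power)
      then have "d ^ t * real s ^ n \<le> d ^ t * (2 ^ t) ^ n"
        using assms by (intro mult_left_mono power_mono) auto
      also have "\<dots> = (d * 2 ^ n) ^ t"
        by (simp add: power_mult_distrib mult.commute flip: power_mult)
      also have "\<dots> \<le> 1"
        using assms by (intro power_le_one) auto
      finally have "d * (d ^ t * real s ^ n) \<le> d * 1"
        using assms by (intro mult_left_mono) auto
      then show ?thesis by (simp add: t mult.assoc)
    qed
    finally show "real (L choose s) * real s ^ n * P ^ (n - s) \<le> d * P ^ n"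
      using assms by (simp add: mult_right_mono)
  qed
  also have "\<dots> = real n * (d * P ^ n)" by simp
  finally show ?thesis .
qed

section \<open>The theorem\<close>

lemma cond_k_bounds:
  assumes "cond_k N \<delta> \<alpha> k" "0 < \<delta>" "0 < \<alpha>" "N > 0"
  shows "2 \<le> k" "\<delta> * 2 ^ (2 * k) \<le> 1"
    "(2 ^ 6 * \<delta> * real k / \<alpha> ^ 2) ^ (2 * k) \<le> real N"
    "(2 ^ 6 * \<delta> ^ 2 / \<alpha> ^ 3) ^ (2 * k) \<le> real N"
proof -
  show k: "2 \<le> k" using assms by (simp add: cond_k_def)
  have "real (2 * k) \<le> log 2 (1 / \<delta>)" using assms by (simp add: cond_k_def)
  then have "2 powr real (2 * k) \<le> 1 / \<delta>"
    using assms by (subst (asm) le_log_iff) auto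
  then show "\<delta> * 2 ^ (2 * k) \<le> 1"
    using assms by (simp only: powr_realpow) (simp add: field_simps)
  have le_N: "x ^ (2 * k) \<le> real N" if "0 < x" "2 * real k * log 2 x \<le> log 2 (real N)" for x
  proof -
    have "log 2 (x ^ (2 * k)) = 2 * real k * log 2 x"
      using that(1) by (simp add: log_nat_power)
    then show ?thesis
      using that assms(4) by (metis log_le_cancel_iff of_nat_0_less_iff one_less_numeral_iff semiring_norm(76) zero_less_power)
  qed
  let ?x = "2 ^ 6 * \<delta> * real k / \<alpha> ^ 2" and ?y = "2 ^ 6 * \<delta> ^ 2 / \<alpha> ^ 3"
  have max: "2 * real k * max (log 2 ?x) (log 2 ?y) \<le> log 2 (real N)"
    using assms(1) unfolding cond_k_def by blast
  show "?x ^ (2 * k) \<le> real N"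
  proof (rule le_N)
    show "2 * real k * log 2 ?x \<le> log 2 (real N)"
      by (rule order.trans[OF mult_left_mono max]) auto
  qed (use assms k in auto)
  show "?y ^ (2 * k) \<le> real N"
  proof (rule le_N)
    show "2 * real k * log 2 ?y \<le> log 2 (real N)"
      by (rule order.trans[OF mult_left_mono max]) auto
  qed (use assms k in auto)
qed

theorem theorem16:
  fixes N :: nat and \<delta> \<alpha> :: real
  assumes "prime N"
    and "0 < \<delta>" "\<delta> \<le> 1" "0 < \<alpha>" "\<alpha> \<le> 1"
    and "32 * \<delta>^2 \<le> \<alpha>" "\<alpha> \<le> \<delta> / 4"
    and "\<exists>k::nat. k > 0 \<and> cond_k N \<delta> \<alpha> k"
  shows "\<exists>A \<subseteq> {..<N}. \<delta> * real N \<le> real (card A) \<and> real (card A) \<le> 3 * \<delta> * real N \<and>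
           real (card (large_spectrum N \<alpha> A)) \<ge> \<delta> / (64 * \<alpha>^2) \<and>
           (\<forall>k::nat. cond_k N \<delta> \<alpha> k \<longrightarrow>
              real (T_energy N k (large_spectrum N \<alpha> A)) \<le> 2 powr (14 * real k) * \<delta> / \<alpha>^(2*k))"
proof -
  note \<delta>\<alpha> = assms(2,4,6,7)
  have N_pos: "N > 0" and N_ge: "N \<ge> 2"
    using assms(1) by (auto simp: prime_gt_0_nat prime_ge_2_nat)
  define K where "K = Max {k. cond_k N \<delta> \<alpha> k}"
  have fin: "finite {k. cond_k N \<delta> \<alpha> k}"
  proof (rule finite_subset)
    show "{k. cond_k N \<delta> \<alpha> k} \<subseteq> {..nat \<lfloor>1/2 * log 2 (1/\<delta>)\<rfloor>}"
      by (auto simp: cond_k_def le_nat_floor)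
  qed simp
  have K: "cond_k N \<delta> \<alpha> K"
    using Max_in[OF fin] assms(8) unfolding K_def by auto
  have K_max: "k \<le> K" if "cond_k N \<delta> \<alpha> k" for k
    using Max_ge[OF fin] that unfolding K_def by auto
  note K_bounds = cond_k_bounds[OF K \<delta>\<alpha>(1,2) N_pos]

  define x where "x = \<delta> ^ 2 / \<alpha> ^ 3"
  define y where "y = \<delta> / \<alpha> ^ 2"
  have "(128 * \<delta>) * \<delta> \<le> 1 * \<delta>"
    using \<delta>\<alpha>(3,4) unfolding power2_eq_square by linarith
  then have "128 * \<delta> \<le> 1"
    using \<delta>\<alpha>(1) by (simp only: mult_le_cancel_right_pos)
  then have \<delta>_le: "\<delta> \<le> 1 / 128" by simp
  then have \<alpha>_le: "\<alpha> \<le> 1 / 512" using \<delta>\<alpha>(4) by linarith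
  have y_ge: "4 / \<alpha> \<le> y"
    using \<delta>\<alpha> by (simp add: y_def field_simps power2_eq_square)
  have y1: "2048 \<le> y"
  proof -
    have "2048 \<le> 4 / \<alpha>" using \<alpha>_le \<delta>\<alpha>(2) by (simp add: field_simps)
    then show ?thesis using y_ge by linarith
  qed
  have x_eq: "x = \<delta> / \<alpha> * y"
    by (simp add: x_def y_def power2_eq_square power3_eq_cube)
  have ratio: "4 \<le> \<delta> / \<alpha>" using \<delta>\<alpha> by (simp add: field_simps)
  have x_ge: "4 * y \<le> x"
    unfolding x_eq using ratio y1 by (intro mult_right_mono) auto
  have x1: "8192 \<le> x" using x_ge y1 by linarith
  have N_x: "(64 * x) ^ 4 \<le> real N"
  proof -
    have "(64 * x) ^ 4 \<le> (64 * x) ^ (2 * K)"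
      using x1 K_bounds(1) by (intro power_increasing) auto
    then show ?thesis using K_bounds(4) by (simp add: x_def)
  qed
  have N_y: "(64 * real K * y) ^ (2 * K) \<le> real N"
    using K_bounds(3) by (simp add: y_def mult_ac)
  have N_y': "(128 * y) ^ (2 * K) \<le> real N"
  proof -
    have "(128 * y) ^ (2 * K) \<le> (64 * real K * y) ^ (2 * K)"
      using K_bounds(1) y1 by (intro power_mono mult_right_mono) auto
    with N_y show ?thesis by linarith
  qed
  have N_Ky: "64 * real K * y \<le> real N"
  proof -
    have "1 \<le> real K * y" using K_bounds(1) y1 mult_mono[of 1 "real K" 1 y] by simp
    then have "(64 * real K * y) ^ 1 \<le> (64 * real K * y) ^ (2 * K)"
      using K_bounds(1) by (intro power_increasing) auto
    with N_y show ?thesis by simp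
  qed
  have N_xx: "(64 * x) ^ 2 * (64 * x) ^ 2 \<le> real N"
    using N_x by (simp flip: power_add)
  have xx: "64 * x \<le> (64 * x) ^ 2"
    using x1 self_le_power[of "64 * x" 2] by simp
  have N_x2: "1000 * (64 * x) ^ 2 \<le> real N"
    using order.trans[OF mult_right_mono[of 1000 "(64 * x) ^ 2" "(64 * x) ^ 2"] N_xx] xx x1 by simp
  have N_x1: "64000 * x \<le> real N" using N_x2 xx by simp

  define L where "L = nat \<lfloor>\<delta> / \<alpha>\<rfloor>"
  define h where "h = nat \<lfloor>3 * \<alpha> * real N\<rfloor>"
  define H where "H = \<lceil>20 * real L / \<alpha>\<rceil>"
  define M where "M = \<lfloor>2 / \<alpha>\<rfloor>"
  define m0 where "m0 = nat \<lfloor>1 / (18 * \<alpha>)\<rfloor>"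
  define T where "T = 35 / 100 * \<alpha> * real N"

  have L_le: "real L \<le> \<delta> / \<alpha>" using ratio by (simp add: L_def)
  have L_ge: "\<delta> / \<alpha> - 1 \<le> real L" using ratio by (simp add: L_def; linarith)
  have L_ge': "3 / 4 * (\<delta> / \<alpha>) \<le> real L" using L_ge ratio by linarith
  have L_pos: "L > 0" using L_ge ratio by (cases L) auto
  have aN: "1000 \<le> \<alpha> * real N"
  proof -
    have "4 \<le> \<alpha> * y" using y_ge \<delta>\<alpha>(2) by (simp add: field_simps)
    moreover have "\<alpha> * (64000 * y) \<le> \<alpha> * real N"
      using N_x1 x_ge y1 \<delta>\<alpha>(2) by (intro mult_left_mono) auto
    ultimately show ?thesis by simp
  qed
  have h_upper: "real h \<le> 3 * \<alpha> * real N" using aN by (simp add: h_def)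
  have h_ge: "3 * \<alpha> * real N - 1 \<le> real h" using aN by (simp add: h_def; linarith)
  have h_pos: "h > 0" using h_ge aN by (cases h) auto
  have h_le_N: "h \<le> N"
  proof -
    have "3 * \<alpha> * real N \<le> 1 * real N"
      using \<alpha>_le by (intro mult_right_mono) auto
    then show ?thesis using h_upper by linarith
  qed
  have H_ge: "20 * real L / \<alpha> \<le> of_int H" by (simp add: H_def)
  have H_le: "of_int H \<le> 21 * y"
  proof -
    have "20 * real L / \<alpha> \<le> 20 * (\<delta> / \<alpha>) / \<alpha>"
      using L_le \<delta>\<alpha>(2) by (intro divide_right_mono mult_left_mono) auto
    also have "\<dots> = 20 * y" by (simp add: y_def power2_eq_square)
    finally show ?thesis using y1 unfolding H_def by linarith
  qed
  have H_real_pos: "0 < real_of_int H"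
  proof -
    have "0 < 20 * real L / \<alpha>" using L_pos \<delta>\<alpha>(2) by simp
    then show ?thesis using H_ge by (rule less_le_trans)
  qed
  have H_less: "H < int N"
    using H_le x_ge N_x1 y1 by linarith
  have M_le: "of_int M \<le> 2 / \<alpha>" by (simp add: M_def)
  have M_ge: "2 / \<alpha> - 1 \<le> of_int M" unfolding M_def by linarith
  have inv_\<alpha>: "512 \<le> 1 / \<alpha>" using \<alpha>_le \<delta>\<alpha>(2) by (simp add: field_simps)
  have M_nonneg: "0 \<le> M" using \<delta>\<alpha>(2) by (simp add: M_def)
  have P_le: "2 * of_int M + 1 \<le> 5 / \<alpha>" using M_le inv_\<alpha> by simp
  have P_ge: "1 / \<alpha> \<le> 2 * of_int M + 1" using M_ge inv_\<alpha> by simp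

  have small: "real L ^ 2 * (1 + real h ^ 2 / real N) / T
      + ((real L * (2 * of_int H + 1)) ^ 2 + (real L * (2 * of_int M + 1)) ^ (2 * K)) / real (N - 1) < 1"
  proof -
    have T_pos: "0 < T" using aN by (simp add: T_def)
    have L2: "real L ^ 2 \<le> (\<delta> / \<alpha>) ^ 2" using L_le by (intro power_mono) auto
    have "real L ^ 2 / T \<le> (\<delta> / \<alpha>) ^ 2 / T"
      using L2 T_pos by (intro divide_right_mono) auto
    also have "\<dots> = x / (35 / 100 * real N)"
      by (simp add: T_def x_def power2_eq_square power3_eq_cube)
    also have "\<dots> \<le> 1 / 100"
      using N_x1 x1 N_pos by (simp add: field_simps)
    finally have s1: "real L ^ 2 / T \<le> 1 / 100" .
    have "real L ^ 2 * (real h ^ 2 / real N) / T \<le> (\<delta> / \<alpha>) ^ 2 * ((3 * \<alpha> * real N) ^ 2 / real N) / T"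
      using L_le T_pos h_upper by (intro divide_right_mono mult_mono power_mono) auto
    also have "\<dots> = 900 / 35 * (\<delta> ^ 2 / \<alpha>)"
      using N_pos \<delta>\<alpha>(2) by (simp add: T_def field_simps power2_eq_square)
    also have "\<dots> \<le> 900 / 35 * (1 / 32)"
      using \<delta>\<alpha> by (intro mult_left_mono) (auto simp: field_simps)
    finally have s2: "real L ^ 2 * (real h ^ 2 / real N) / T \<le> 900 / 35 * (1 / 32)" .
    have "real L * (2 * of_int H + 1) \<le> \<delta> / \<alpha> * (43 * y)"
      using L_le H_le y1 H_real_pos \<delta>\<alpha> by (intro mult_mono) auto
    also have "\<dots> = 43 * x" by (simp add: x_eq)
    also have "\<dots> \<le> 64 * x" using x1 by simp
    finally have "(real L * (2 * of_int H + 1)) ^ 2 \<le> (64 * x) ^ 2"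
      using H_real_pos by (intro power_mono) auto
    then have s3: "(real L * (2 * of_int H + 1)) ^ 2 \<le> real N / 1000"
      using N_x2 by linarith
    have "real L * (2 * of_int M + 1) \<le> \<delta> / \<alpha> * (5 / \<alpha>)"
      using L_le P_le \<delta>\<alpha> M_nonneg by (intro mult_mono) auto
    also have "\<dots> = 5 * y" by (simp add: y_def power2_eq_square)
    also have "\<dots> \<le> 1 / 10 * (128 * y)" using y1 by simp
    finally have "(real L * (2 * of_int M + 1)) ^ (2 * K) \<le> (1 / 10 * (128 * y)) ^ (2 * K)"
      using M_nonneg by (intro power_mono) auto
    also have "\<dots> = (1 / 10) ^ (2 * K) * (128 * y) ^ (2 * K)"
      by (rule power_mult_distrib)
    also have "\<dots> \<le> (1 / 10) ^ 3 * real N"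
      using N_y' K_bounds(1) y1 by (intro mult_mono power_decreasing) auto
    finally have s4: "(real L * (2 * of_int M + 1)) ^ (2 * K) \<le> real N / 1000"
      by (simp add: power3_eq_cube)
    have "((real L * (2 * of_int H + 1)) ^ 2 + (real L * (2 * of_int M + 1)) ^ (2 * K)) / real (N - 1)
        \<le> (real N / 1000 + real N / 1000) / (real N / 2)"
      using s3 s4 N_ge M_nonneg by (intro frac_le add_mono) auto
    also have "\<dots> = 4 / 1000" using N_pos by simp
    finally have s5: "((real L * (2 * of_int H + 1)) ^ 2 + (real L * (2 * of_int M + 1)) ^ (2 * K)) / real (N - 1)
        \<le> 4 / 1000" .
    have "real L ^ 2 * (1 + real h ^ 2 / real N) / T
        = real L ^ 2 / T + real L ^ 2 * (real h ^ 2 / real N) / T"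
      by (simp add: distrib_left add_divide_distrib)
    also have "\<dots> \<le> 1 / 100 + 900 / 35 * (1 / 32)"
      using s1 s2 by (rule add_mono)
    finally have "real L ^ 2 * (1 + real h ^ 2 / real N) / T
      + ((real L * (2 * of_int H + 1)) ^ 2 + (real L * (2 * of_int M + 1)) ^ (2 * K)) / real (N - 1)
      \<le> (1 / 100 + 900 / 35 * (1 / 32)) + 4 / 1000"
      using s5 by (rule add_mono)
    also have "\<dots> < 1" by simp
    finally show ?thesis .
  qed
  have KM: "int (2 * K) * M < int N"
  proof -
    have "real (2 * K) * of_int M \<le> real (2 * K) * (2 / \<alpha>)"
      using M_le by (intro mult_left_mono) auto
    also have "\<dots> \<le> real (2 * K) * y"
      using y_ge inv_\<alpha> by (intro mult_left_mono) auto
    also have "\<dots> < 64 * real K * y"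
      using K_bounds(1) y1 by simp
    also have "\<dots> \<le> real N" by (rule N_Ky)
    finally have "real_of_int (int (2 * K) * M) < real_of_int (int N)" by simp
    then show ?thesis by (simp only: of_int_less_iff)
  qed
  obtain q where sep: "separated_dilates N L h H T q"
    and diss: "\<And>k j \<mu>. \<lbrakk>k \<le> 2 * K; j \<in> {..<k} \<rightarrow>\<^sub>E {..<L}; \<mu> \<in> {..<k} \<rightarrow>\<^sub>E {- M..M};
        [(\<Sum>i<k. \<mu> i * int (q (j i))) = 0] (mod int N)\<rbrakk>
      \<Longrightarrow> \<forall>l<L. (\<Sum>i | i < k \<and> j i = l. \<mu> i) = 0"
  proof (rule exists_separated_dilates[OF assms(1) h_pos h_le_N L_pos _ _ H_less M_nonneg KM small])
    show "0 < T" using aN by (simp add: T_def)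
    show "0 < H" using H_real_pos by simp
  qed blast
  interpret separated_dilates N L h H T q by (rule sep)
  have err_le: "err \<le> 4 / 10 * (\<alpha> * real N)"
  proof -
    have "real L / of_int H \<le> \<alpha> / 20"
      using H_ge H_real_pos \<delta>\<alpha>(2) by (simp add: field_simps)
    then have "real L / of_int H * real N \<le> \<alpha> / 20 * real N"
      by (rule mult_right_mono) simp
    moreover have "real L * (real N / of_int H) = real L / of_int H * real N" by simp
    moreover have "T = 35 / 100 * (\<alpha> * real N)" by (simp add: T_def)
    ultimately show ?thesis unfolding err_def by argo
  qed
  show ?thesis
  proof (intro exI[of _ A] conjI allI impI)
    show "A \<subseteq> {..<N}" by (rule A_subset)
    show "real (card A) \<le> 3 * \<delta> * real N"
    proof -
      have "real (card A) \<le> real (L * h)"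
        using card_A_le by (simp only: of_nat_le_iff)
      also have "\<dots> \<le> \<delta> / \<alpha> * (3 * \<alpha> * real N)"
        using L_le h_upper \<delta>\<alpha> by (simp only: of_nat_mult) (intro mult_mono, auto)
      also have "\<dots> = 3 * \<delta> * real N" using \<delta>\<alpha>(2) by simp
      finally show ?thesis .
    qed
    show "\<delta> * real N \<le> real (card A)"
    proof -
      have "897 / 400 * (\<delta> * real N) = 3 / 4 * (\<delta> / \<alpha>) * (299 / 100 * (\<alpha> * real N))"
        using \<delta>\<alpha>(2) by simp
      also have "\<dots> \<le> real L * real h"
        using L_ge' h_ge aN \<delta>\<alpha> by (intro mult_mono) auto
      finally have Lh: "897 / 400 * (\<delta> * real N) \<le> real L * real h" .
      have "\<alpha> * real N \<le> \<delta> / 4 * real N"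
        using \<delta>\<alpha>(4) by (rule mult_right_mono) simp
      then have "T \<le> 35 / 400 * (\<delta> * real N)" by (simp add: T_def)
      moreover have "0 \<le> \<delta> * real N" using \<delta>\<alpha>(1) by simp
      moreover have "real L * real h - T \<le> real (card A)"
        using card_A by (simp add: abs_le_iff)
      ultimately show ?thesis using Lh by argo
    qed
    show "\<delta> / (64 * \<alpha> ^ 2) \<le> real (card (large_spectrum N \<alpha> A))"
    proof -
      have m0_le: "real m0 \<le> 1 / (18 * \<alpha>)" using \<delta>\<alpha>(2) by (simp add: m0_def)
      have "1 / (18 * \<alpha>) - 1 \<le> real m0"
        using \<delta>\<alpha>(2) by (simp add: m0_def; linarith)
      then have m0_ge: "1 / \<alpha> * (1 / 20) \<le> real m0" using inv_\<alpha> by simp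
      have m0_H: "int m0 \<le> H"
      proof -
        have "1 / (18 * \<alpha>) \<le> 20 * real L / \<alpha>"
          using L_pos \<delta>\<alpha>(2) by (simp add: field_simps)
        then show ?thesis using m0_le H_ge by linarith
      qed
      have "real m0 * real h \<le> 1 / (18 * \<alpha>) * (3 * \<alpha> * real N)"
        using m0_le h_upper \<delta>\<alpha>(2) by (intro mult_mono) auto
      then have "6 * (real m0 * real h) \<le> real N"
        using \<delta>\<alpha>(2) by simp
      then have "real (6 * m0 * h) \<le> real N" by simp
      then have m0_h: "6 * m0 * h \<le> N" by (simp only: of_nat_le_iff)
      have "L * m0 \<le> card (large_spectrum N \<alpha> A)"
      proof (rule card_large_spectrum_ge[OF m0_H m0_h h_pos])
        show "m0 < N" using m0_H H_less by linarith
        show "\<alpha> * real N + err \<le> real h / 2"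
          using err_le h_ge aN by simp
      qed
      then have "real L * real m0 \<le> real (card (large_spectrum N \<alpha> A))"
        by (metis of_nat_le_iff of_nat_mult)
      moreover have "3 / 4 * (\<delta> / \<alpha>) * (1 / \<alpha> * (1 / 20)) \<le> real L * real m0"
        using L_ge' m0_ge \<delta>\<alpha> by (intro mult_mono) auto
      moreover have "\<delta> / (64 * \<alpha> ^ 2) \<le> 3 / 4 * (\<delta> / \<alpha>) * (1 / \<alpha> * (1 / 20))"
        using \<delta>\<alpha> by (simp add: field_simps power2_eq_square)
      ultimately show ?thesis by linarith
    qed
    fix k assume k: "cond_k N \<delta> \<alpha> k"
    note k_bounds = cond_k_bounds[OF k \<delta>\<alpha>(1,2) N_pos]
    define P where "P = 2 * real_of_int M + 1"
    have P_pos: "0 < P" using M_nonneg by (simp add: P_def)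
    have card_B: "real (card {- M..M}) = P"
      using M_nonneg by (simp add: P_def)
    have "T_energy N k (large_spectrum N \<alpha> A) \<le> card (balanced (k + k) L {- M..M})"
    proof (rule T_energy_le_card_balanced[where q = q])
      show "\<exists>j<L. \<exists>m\<in>{- M..M}. [int r = m * int (q j)] (mod int N)"
        if r: "r \<in> large_spectrum N \<alpha> A" for r
      proof -
        obtain j m where "j < L" "\<bar>m\<bar> \<le> \<lfloor>2 / \<alpha>\<rfloor>" "[int r = m * int (q j)] (mod int N)"
        proof (rule large_spectrum_subset[OF \<delta>\<alpha>(2) _ r])
          show "2 * err \<le> \<alpha> * real N" using err_le aN by simp
        qed blast
        moreover from this have "m \<in> {- M..M}" by (auto simp: M_def)
        ultimately show ?thesis by blast
      qed
      show "\<forall>l<L. (\<Sum>i | i < k + k \<and> j i = l. \<mu> i) = 0"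
        if "j \<in> {..<k + k} \<rightarrow>\<^sub>E {..<L}" "\<mu> \<in> {..<k + k} \<rightarrow>\<^sub>E {- M..M}"
          "[(\<Sum>i<k + k. \<mu> i * int (q (j i))) = 0] (mod int N)" for j \<mu>
        using diss[OF _ that] K_max[OF k] by simp
    qed (use N_pos in \<open>auto simp: large_spectrum_def\<close>)
    also have "\<dots> \<le> (\<Sum>s = 1..2 * k. (L choose s) * s ^ (2 * k) * card {- M..M} ^ (2 * k - s))"
      unfolding mult_2 by (rule card_balanced_le) (use k_bounds(1) in auto)
    finally have "real (T_energy N k (large_spectrum N \<alpha> A))
        \<le> real (\<Sum>s = 1..2 * k. (L choose s) * s ^ (2 * k) * card {- M..M} ^ (2 * k - s))"
      by (simp only: of_nat_le_iff)
    also have "\<dots> = (\<Sum>s = 1..2 * k. real (L choose s) * real s ^ (2 * k) * P ^ (2 * k - s))"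
      by (simp only: of_nat_sum of_nat_mult of_nat_power card_B)
    also have "\<dots> \<le> real (2 * k) * (\<delta> * P ^ (2 * k))"
    proof (rule sum_choose_power_le[OF \<delta>\<alpha>(1) k_bounds(2) _ P_pos])
      have "\<delta> * (1 / \<alpha>) \<le> \<delta> * P"
        using P_ge \<delta>\<alpha>(1) unfolding P_def by (intro mult_left_mono) auto
      then show "real L \<le> \<delta> * P" using L_le by simp
    qed
    also have "\<dots> \<le> real (2 * k) * (\<delta> * (5 / \<alpha>) ^ (2 * k))"
      using P_le P_pos \<delta>\<alpha>(1) unfolding P_def by (intro mult_left_mono power_mono) auto
    also have "\<dots> = (real (2 * k) * 5 ^ (2 * k)) * (\<delta> / \<alpha> ^ (2 * k))"
      by (simp add: power_divide)
    also have "\<dots> \<le> 2 ^ (14 * k) * (\<delta> / \<alpha> ^ (2 * k))"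
    proof (rule mult_right_mono)
      have "real (2 * k) * 5 ^ (2 * k) \<le> 2 ^ (2 * k) * 8 ^ (2 * k)"
        using of_nat_less_two_power[of "2 * k", where 'a = real]
        by (intro mult_mono power_mono) auto
      also have "\<dots> = 2 ^ (2 * k) * (2 ^ 3) ^ (2 * k)" by simp
      also have "\<dots> = (2 :: real) ^ (8 * k)"
        unfolding power_mult[symmetric] power_add[symmetric] by simp
      also have "\<dots> \<le> 2 ^ (14 * k)" by (intro power_increasing) auto
      finally show "real (2 * k) * 5 ^ (2 * k) \<le> 2 ^ (14 * k)" .
    qed (use \<delta>\<alpha> in auto)
    also have "(2 :: real) ^ (14 * k) = 2 powr (14 * real k)"
      using powr_realpow[of 2 "14 * k"] by simp
    finally show "real (T_energy N k (large_spectrum N \<alpha> A)) \<le> 2 powr (14 * real k) * \<delta> / \<alpha> ^ (2 * k)"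
      by simp
  qed
qed

end
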